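(* Let $\omega \in H^{-1}_{\mathrm{loc}}(\mathbb{R}^2)\cap \mathcal{M}$ and $u = K\ast \omega$. If there exist constants $C>0$ and $\beta>0$ such that $$M_r(\omega) \le C r^{\beta}\quad \text{for all } r>0,$$ then $$\frac{1}{|B_r(0)|}\int_{B_r(0)} \int_{\mathbb{R}^2} |u(x+h)-u(x)|^2\, dx \, dh \le \frac{C}{\beta} \Vert \omega \Vert_{\mathcal{M}}\, r^{\beta} \quad \text{for all } r>0.$$
   Context: $\mathcal{M}$ is the space of finite signed Radon measures on $\mathbb{R}^2$ with total variation norm $\Vert\cdot\Vert_{\mathcal{M}}$. The vorticity maximal function of $\omega\in\mathcal{M}$ is $M_r(\omega) := \sup_{x\in\mathbb{R}^2} |\omega|(\overline{B}_r(x))$, where $\overline{B}_r(x)$ is the closed ball of radius $r$ around $x$ and $|\omega|$ is the variation of $\omega$. The kernel is $K(x) = \frac{1}{2\pi}\frac{x^\perp}{|x|^2}$, $x^\perp = (-x_2,x_1)$, and $u(x) = (K\ast\omega)(x) = \int_{\mathbb{R}^2} K(x-y)\,d\omega(y)$ (defined for almost every $x$). *)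

theory Defs
  imports "HOL-Analysis.Analysis"
begin

section \<open>Finite signed Borel measures\<close>

text \<open>
  A finite signed measure is a real-valued set function; its values matter only on Borel
  sets. On \<open>real^2\<close> every finite signed Borel measure is a Radon measure.
\<close>

definition finite_signed_measures :: "('a::topological_space set \<Rightarrow> real) set" where
  "finite_signed_measures = {\<omega>. \<omega> {} = 0 \<and>
     (\<forall>A::nat \<Rightarrow> 'a set. range A \<subseteq> sets borel \<longrightarrow> disjoint_family A \<longrightarrow>
        (\<lambda>n. \<omega> (A n)) sums \<omega> (\<Union>n. A n))}"

definition variation :: "('a::topological_space set \<Rightarrow> real) \<Rightarrow> 'a set \<Rightarrow> ennreal" where
  "variation \<omega> A =
     (SUP P \<in> {P. finite P \<and> P \<subseteq> sets borel \<and> partition_on A P}. \<Sum>B\<in>P. ennreal \<bar>\<omega> B\<bar>)"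

definition tv_norm :: "('a::topological_space set \<Rightarrow> real) \<Rightarrow> real" where
  "tv_norm \<omega> = enn2real (variation \<omega> UNIV)"

text \<open>
  The Jordan decomposition \<open>\<omega> = \<omega>\<^sup>+ - \<omega>\<^sup>-\<close> with \<open>\<omega>\<^sup>+ = (|\<omega>| + \<omega>) / 2\<close> and
  \<open>\<omega>\<^sup>- = (|\<omega>| - \<omega>) / 2\<close>. The variation of a finite signed measure is finite, so
  \<open>enn2real\<close> loses nothing here or in \<open>tv_norm\<close>.
\<close>

definition pos_part_measure :: "('a::topological_space set \<Rightarrow> real) \<Rightarrow> 'a measure" where
  "pos_part_measure \<omega> =
     measure_of UNIV (sets borel) (\<lambda>A. ennreal ((enn2real (variation \<omega> A) + \<omega> A) / 2))"

definition neg_part_measure :: "('a::topological_space set \<Rightarrow> real) \<Rightarrow> 'a measure" where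
  "neg_part_measure \<omega> =
     measure_of UNIV (sets borel) (\<lambda>A. ennreal ((enn2real (variation \<omega> A) - \<omega> A) / 2))"

definition signed_integral ::
    "('a::topological_space set \<Rightarrow> real) \<Rightarrow> ('a \<Rightarrow> 'b::{banach, second_countable_topology}) \<Rightarrow> 'b"
  where
  "signed_integral \<omega> f =
     integral\<^sup>L (pos_part_measure \<omega>) f - integral\<^sup>L (neg_part_measure \<omega>) f"


section \<open>The space \<open>H\<^sup>-\<^sup>1\<^sub>l\<^sub>o\<^sub>c\<close>\<close>

definition gradient :: "(real^'n \<Rightarrow> real) \<Rightarrow> real^'n \<Rightarrow> real^'n" where
  "gradient f x = (\<chi> i. frechet_derivative f (at x) (axis i 1))"

primrec C_k :: "nat \<Rightarrow> (real^'n \<Rightarrow> real) \<Rightarrow> bool" where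
  "C_k 0 f \<longleftrightarrow> continuous_on UNIV f"
| "C_k (Suc k) f \<longleftrightarrow>
     (\<forall>x. f differentiable (at x)) \<and> (\<forall>i. C_k k (\<lambda>x. gradient f x $ i))"

definition test_functions :: "(real^'n) set \<Rightarrow> (real^'n \<Rightarrow> real) set" where
  "test_functions U = {\<phi>. (\<forall>k. C_k k \<phi>) \<and>
     compact (closure {x. \<phi> x \<noteq> 0}) \<and> closure {x. \<phi> x \<noteq> 0} \<subseteq> U}"

definition H1_norm :: "(real^'n \<Rightarrow> real) \<Rightarrow> real" where
  "H1_norm \<phi> = sqrt (\<integral>x. (\<phi> x)\<^sup>2 + (norm (gradient \<phi> x))\<^sup>2 \<partial>lborel)"

text \<open>
  A distribution \<open>T\<close> lies in \<open>H\<^sup>-\<^sup>1\<^sub>l\<^sub>o\<^sub>c\<close> if its restriction to every bounded open \<open>U\<close> lies in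
  \<open>H\<^sup>-\<^sup>1(U)\<close>, the dual of \<open>H\<^sup>1\<^sub>0(U)\<close>. As \<open>H\<^sup>1\<^sub>0(U)\<close> is the closure of the test functions on
  \<open>U\<close> in the \<open>H\<^sup>1\<close> norm, this says that \<open>T\<close> is a linear functional on the test functions
  that is bounded in that norm on those supported in \<open>U\<close>; continuity of \<open>T\<close> in the sense
  of distributions is then automatic.
\<close>

definition H_minus1_loc :: "((real^'n \<Rightarrow> real) \<Rightarrow> real) set" where
  "H_minus1_loc = {T.
     (\<forall>\<phi>\<in>test_functions UNIV. \<forall>\<psi>\<in>test_functions UNIV. \<forall>a b.
        T (\<lambda>x. a * \<phi> x + b * \<psi> x) = a * T \<phi> + b * T \<psi>) \<and>
     (\<forall>U. open U \<and> bounded U \<longrightarrow>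
        (\<exists>c. \<forall>\<phi>\<in>test_functions U. \<bar>T \<phi>\<bar> \<le> c * H1_norm \<phi>))}"

definition distribution_of :: "((real^'n) set \<Rightarrow> real) \<Rightarrow> (real^'n \<Rightarrow> real) \<Rightarrow> real" where
  "distribution_of \<omega> = (\<lambda>\<phi>. signed_integral \<omega> \<phi>)"


section \<open>Vorticity and velocity\<close>

definition vort_maximal :: "real \<Rightarrow> ((real^2) set \<Rightarrow> real) \<Rightarrow> ennreal" where
  "vort_maximal r \<omega> = (SUP x. variation \<omega> (cball x r))"

definition perp :: "real^2 \<Rightarrow> real^2" where
  "perp x = vector [- (x $ 2), x $ 1]"

definition biot_savart_kernel :: "real^2 \<Rightarrow> real^2" where
  "biot_savart_kernel x = (1 / (2 * pi)) *\<^sub>R (perp x /\<^sub>R (norm x)\<^sup>2)"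

text \<open>
  The convolution \<open>K * \<omega>\<close>. The Bochner integral assigns the value 0 to a non-integrable
  function, which affects \<open>velocity\<close> only on a Lebesgue null set.
\<close>

definition velocity :: "((real^2) set \<Rightarrow> real) \<Rightarrow> real^2 \<Rightarrow> real^2" where
  "velocity \<omega> x = signed_integral \<omega> (\<lambda>y. biot_savart_kernel (x - y))"

end

theory Submission
  imports Defs "HOL-Complex_Analysis.Cauchy_Integral_Formula" "HOL-Real_Asymp.Real_Asymp"
begin

text \<open>
  Identify the plane with the complex numbers, so that \<open>K * \<mu>\<close> becomes, up to conjugation and the
  factor \<open>1 / (2 pi)\<close>, the Cauchy transform \<open>f(x) = \<integral> 1 / (x - y) d\<mu>(y)\<close>.
  Let \<open>\<mu>\<close> be positive with compact support and let \<open>f\<^sub>r\<close> be the mean of \<open>f\<close> over discs of radius \<open>r\<close>.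
  The mean over \<open>h\<close> of \<open>|f(x+h) - f(x)|\<^sup>2\<close> is the disc mean of \<open>|f|\<^sup>2\<close> minus \<open>|f(x)|\<^sup>2\<close>, whose
  integral over large discs is at most a boundary term that vanishes because \<open>f(x) = O(1/|x|)\<close>, plus twice the real part of
  \<open>(f - f\<^sub>r) cnj f\<close>. The kernel of \<open>f - f\<^sub>r\<close> is \<open>(1 - |v|\<^sup>2/r\<^sup>2) / v\<close> cut off at \<open>|v| < r\<close>. By Cauchy's
  formula the mean over rotations of \<open>v\<close> of \<open>(1/v) cnj (1/(v+w))\<close> is \<open>1/|v|\<^sup>2\<close> if \<open>|w| < |v|\<close> and 0 if
  \<open>|w| > |v|\<close>. So the integral of the last term equals twice the integral of
  \<open>1/|v|\<^sup>2 - 1/r\<^sup>2\<close> over \<open>|y - z| < |v| < r\<close>, and the growth condition bounds the mass of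
  \<open>{z. |y - z| < |v|}\<close> by \<open>C |v|\<^sup>\<beta>\<close>. Fatou's lemma removes the support condition.
  For positive \<open>\<mu>\<close> this yields the constant \<open>C / (pi \<beta>)\<close>. Applying
  \<open>|a - b|\<^sup>2 \<le> 2|a|\<^sup>2 + 2|b|\<^sup>2\<close> to the two parts of the Jordan decomposition of \<open>\<omega>\<close> costs a factor 2, which is
  affordable since \<open>2 < pi\<close>.
\<close>

section \<open>The Jordan decomposition\<close>

lemma fsm_sums:
  assumes "\<omega> \<in> finite_signed_measures" "\<And>n::nat. A n \<in> sets borel" "disjoint_family A"
  shows "(\<lambda>n. \<omega> (A n)) sums \<omega> (\<Union>n. A n)"
  using assms unfolding finite_signed_measures_def by blast

lemma fsm_empty: "\<omega> \<in> finite_signed_measures \<Longrightarrow> \<omega> {} = 0"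
  unfolding finite_signed_measures_def by blast

lemma fsm_Un:
  assumes "\<omega> \<in> finite_signed_measures" "A \<in> sets borel" "B \<in> sets borel" "A \<inter> B = {}"
  shows "\<omega> (A \<union> B) = \<omega> A + \<omega> B"
proof -
  have "(\<lambda>n. \<omega> (binaryset A B n)) sums \<omega> (\<Union>n. binaryset A B n)"
    using assms by (intro fsm_sums) (auto simp: binaryset_def disjoint_family_on_def)
  moreover have "(\<lambda>n. \<omega> (binaryset A B n)) sums (\<omega> A + \<omega> B)"
    by (rule binaryset_sums) (use assms fsm_empty in auto)
  ultimately show ?thesis
    using sums_unique2 UN_binaryset_eq by metis
qed

lemma fsm_Diff:
  assumes "\<omega> \<in> finite_signed_measures" "A \<in> sets borel" "B \<in> sets borel" "B \<subseteq> A"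
  shows "\<omega> (A - B) = \<omega> A - \<omega> B"
  using fsm_Un[OF assms(1), of B "A - B"] assms by (simp add: Un_absorb1)

lemma fsm_sum:
  assumes "\<omega> \<in> finite_signed_measures" "finite P" "P \<subseteq> sets borel" "disjoint P"
  shows "\<omega> (\<Union>P) = (\<Sum>B\<in>P. \<omega> B)"
  using assms(2-)
proof (induction P rule: finite_induct)
  case empty
  then show ?case using fsm_empty[OF assms(1)] by simp
next
  case (insert B P)
  have "B \<inter> \<Union>P = {}"
    using insert.hyps(2) insert.prems(2) by (fastforce simp: pairwise_insert disjnt_iff)
  moreover have "\<Union>P \<in> sets borel"
    using insert by (intro sets.finite_Union) auto
  ultimately have "\<omega> (B \<union> \<Union>P) = \<omega> B + \<omega> (\<Union>P)"
    using insert.prems by (intro fsm_Un assms) auto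
  then show ?case
    using insert by (simp add: pairwise_insert)
qed

section \<open>Positive sets and the Hahn decomposition\<close>

definition positive_set :: "('a::topological_space set \<Rightarrow> real) \<Rightarrow> 'a set \<Rightarrow> bool" where
  "positive_set \<omega> A \<longleftrightarrow> A \<in> sets borel \<and> (\<forall>B\<in>sets borel. B \<subseteq> A \<longrightarrow> 0 \<le> \<omega> B)"

text \<open>A subset of the union is cut into disjoint pieces, each inside a single
  \<open>P n\<close>; countable additivity adds up their nonnegative values.\<close>

lemma positive_set_UN:
  assumes "\<omega> \<in> finite_signed_measures" "\<And>n::nat. positive_set \<omega> (P n)"
  shows "positive_set \<omega> (\<Union>n. P n)"
  unfolding positive_set_def
proof (intro conjI ballI impI)
  show "(\<Union>n. P n) \<in> sets borel"
    using assms(2) unfolding positive_set_def by auto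
  fix B :: "'a set" assume B: "B \<in> sets borel" "B \<subseteq> (\<Union>n. P n)"
  define D where "D = disjointed (\<lambda>n. B \<inter> P n)"
  have sub: "D n \<subseteq> P n" for n
    using disjointed_subset[of "\<lambda>n. B \<inter> P n" n] by (auto simp: D_def)
  have meas: "D n \<in> sets borel" for n
  proof -
    have "range (\<lambda>n. B \<inter> P n) \<subseteq> sets borel"
      using assms(2) B unfolding positive_set_def by auto
    from sets.range_disjointed_sets[OF this] show ?thesis
      by (auto simp: D_def)
  qed
  have "(\<Union>n. D n) = B"
    using B(2) by (auto simp: D_def UN_disjointed_eq)
  moreover have "(\<lambda>n. \<omega> (D n)) sums \<omega> (\<Union>n. D n)"
    by (intro fsm_sums assms meas) (simp add: D_def disjoint_family_disjointed)
  ultimately have sums: "(\<lambda>n. \<omega> (D n)) sums \<omega> B" by simp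
  have nn: "0 \<le> \<omega> (D n)" for n
    using assms(2)[of n] sub meas unfolding positive_set_def by blast
  show "0 \<le> \<omega> B"
    by (rule sums_le[OF nn sums_zero sums])
qed

lemma positive_set_Un:
  assumes "\<omega> \<in> finite_signed_measures" "positive_set \<omega> A" "positive_set \<omega> B"
  shows "positive_set \<omega> (A \<union> B)"
proof -
  have "positive_set \<omega> (\<Union>n::nat. if n = 0 then A else B)"
    using assms by (intro positive_set_UN) auto
  also have "(\<Union>n::nat. if n = 0 then A else B) = A \<union> B"
    by (auto split: if_splits)
  finally show ?thesis .
qed

lemma positive_set_mono:
  assumes "\<omega> \<in> finite_signed_measures" "positive_set \<omega> A" "B \<in> sets borel" "B \<subseteq> A"
  shows "\<omega> B \<le> \<omega> A"
proof -
  have A: "A \<in> sets borel"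
    using assms(2) by (simp add: positive_set_def)
  have "A - B \<in> sets borel" using A assms(3) by blast
  then have "0 \<le> \<omega> (A - B)"
    using assms(2) by (auto simp: positive_set_def)
  with A show ?thesis
    using fsm_Diff[OF assms(1) _ assms(3,4)] by simp
qed

text \<open>
  Truncation at \<open>M\<close> makes greedy choices possible before \<open>\<omega>\<close> is known to be bounded.
\<close>

lemma exists_almost_maximal:
  fixes g :: "'b \<Rightarrow> real"
  assumes "x0 \<in> S" "e > 0"
  shows "\<exists>x\<in>S. \<forall>y\<in>S. min M (g y) - e \<le> g x"
proof -
  let ?T = "(\<lambda>y. min M (g y)) ` S"
  have bdd: "bdd_above ?T" by (auto intro!: bdd_aboveI[of _ M])
  have "Sup ?T - e < Sup ?T" using assms by simp
  then obtain x where "x \<in> S" "Sup ?T - e < min M (g x)"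
    using less_cSupD[of ?T] assms by blast
  moreover have "min M (g y) \<le> Sup ?T" if "y \<in> S" for y
    using that bdd by (intro cSup_upper) auto
  ultimately show ?thesis
    by (intro bexI[of _ x]) fastforce+
qed

text \<open>Greedy exhaustion: pieces of almost most negative value are removed from
  \<open>D\<close> one after the other. This can only raise the value of \<open>\<omega>\<close>,
  and since the values of the removed pieces are summable, no subset of negative value
  survives.\<close>

lemma exists_positive_subset:
  assumes \<omega>: "\<omega> \<in> finite_signed_measures" and D: "D \<in> sets borel"
  shows "\<exists>A\<subseteq>D. positive_set \<omega> A \<and> \<omega> D \<le> \<omega> A"
proof -
  \<comment> \<open>\<open>B\<close> must realise at least half of every truncated value
    \<open>min 1 (- \<omega> B')\<close> available inside \<open>A\<close>.\<close>
  let ?good = "\<lambda>A B. B \<in> sets borel \<and> B \<subseteq> A \<and> \<omega> B \<le> 0 \<and>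
      (\<forall>B'\<in>sets borel. B' \<subseteq> A \<longrightarrow> min 1 (- \<omega> B') / 2 \<le> - \<omega> B)"
  have ex: "\<exists>B. ?good A B" for A :: "'a set"
  proof -
    let ?S = "{B \<in> sets borel. B \<subseteq> A}"
    show ?thesis
    proof (cases "\<exists>B0\<in>?S. \<omega> B0 < 0")
      case False
      have "min 1 (- \<omega> B) / 2 \<le> - \<omega> {}" if "B \<in> sets borel" "B \<subseteq> A" for B
      proof -
        have "0 \<le> \<omega> B" using False that not_less by blast
        then have "min 1 (- \<omega> B) \<le> 0" by linarith
        then show ?thesis by (simp add: fsm_empty[OF \<omega>])
      qed
      moreover have "\<omega> {} \<le> 0" by (simp add: fsm_empty[OF \<omega>])
      ultimately have "?good A {}" by (intro conjI ballI impI) auto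
      then show ?thesis by blast
    next
      case True
      then obtain B0 where B0: "B0 \<in> ?S" "\<omega> B0 < 0" by blast
      \<comment> \<open>With this slack, comparison with \<open>B0\<close> gives
        \<open>e \<le> - \<omega> B\<close>; hence any \<open>B'\<close> satisfies \<open>min 1 (-
        \<omega> B') \<le> - \<omega> B + e \<le> 2 * (- \<omega> B)\<close>.\<close>
      define e where "e = min 1 (- \<omega> B0) / 2"
      have "e > 0" using B0 by (auto simp: e_def)
      from exists_almost_maximal[OF B0(1) this, of 1 "\<lambda>B. - \<omega> B"]
      obtain B where B: "B \<in> ?S" "\<forall>B'\<in>?S. min 1 (- \<omega> B') - e \<le> - \<omega> B" by blast
      have "e \<le> - \<omega> B" using B(2) B0(1) by (force simp: e_def)
      moreover have "min 1 (- \<omega> B') / 2 \<le> - \<omega> B" if "B' \<in> ?S" for B'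
        using B(2) that \<open>e \<le> - \<omega> B\<close> by fastforce
      ultimately have "?good A B" using B(1) \<open>e > 0\<close> by auto
      then show ?thesis by blast
    qed
  qed
  then obtain b where b: "\<And>A. ?good A (b A)" by metis
  define a where "a = rec_nat D (\<lambda>_ A. A - b A)"
  have a_simps: "a 0 = D" "a (Suc n) = a n - b (a n)" for n
    by (simp_all add: a_def)
  define B where "B n = b (a n)" for n
  have Bm: "B n \<in> sets borel" and Ba: "B n \<subseteq> a n" and Bneg: "\<omega> (B n) \<le> 0" for n
    using b unfolding B_def by blast+
  have dec: "a m \<subseteq> a n" if "n \<le> m" for n m
    using that by (induction rule: dec_induct) (auto simp: a_simps)
  have disj: "disjoint_family B"
    unfolding disjoint_family_on_def
  proof safe
    fix m n x assume "m \<noteq> n" "x \<in> B m" "x \<in> B n"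
    then show "x \<in> {}"
    proof (induction m n rule: linorder_wlog)
      case (le m n)
      then have "x \<in> a (Suc m)" using Ba[of n] dec[of "Suc m" n] by auto
      then show ?case using le by (auto simp: a_simps B_def)
    qed auto
  qed
  have Aeq: "x \<in> a n" if "x \<in> D" "\<forall>n. x \<notin> B n" for x n
    using that by (induction n) (auto simp: a_simps B_def)
  let ?A = "D - (\<Union>n. B n)"
  have sums: "(\<lambda>n. \<omega> (B n)) sums \<omega> (\<Union>n. B n)"
    by (intro fsm_sums \<omega> Bm disj)
  have UB: "(\<Union>n. B n) \<subseteq> D" using Ba dec[of 0] a_simps by blast
  have UBm: "(\<Union>n. B n) \<in> sets borel" using Bm by auto
  have "\<omega> (\<Union>n. B n) \<le> 0"
    using sums_le[OF _ sums sums_zero] Bneg by simp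
  then have le: "\<omega> D \<le> \<omega> ?A"
    using fsm_Diff[OF \<omega> D UBm UB] by simp
  \<comment> \<open>The value of the union is a real number, so the series converges and its terms
    tend to 0.\<close>
  have "(\<lambda>n. \<omega> (B n)) \<longlonglongrightarrow> 0"
    using sums summable_LIMSEQ_zero sums_summable by blast
  then have lim: "(\<lambda>n. - \<omega> (B n)) \<longlonglongrightarrow> 0"
    by (auto dest: tendsto_minus)
  have "positive_set \<omega> ?A"
    unfolding positive_set_def
  proof (intro conjI ballI impI)
    show "?A \<in> sets borel" using D UBm by auto
    fix C :: "'a set" assume C: "C \<in> sets borel" "C \<subseteq> ?A"
    \<comment> \<open>A surviving \<open>C\<close> was a competitor in every round, so half of its
      truncated negative value is at most \<open>- \<omega> (B n)\<close> for all
      \<open>n\<close>.\<close>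
    have "C \<subseteq> a n" for n using C Aeq by blast
    then have "min 1 (- \<omega> C) / 2 \<le> - \<omega> (B n)" for n
      using b[of "a n"] C unfolding B_def by blast
    then have "min 1 (- \<omega> C) / 2 \<le> 0"
      using lim by (meson LIMSEQ_le_const)
    then show "0 \<le> \<omega> C" by (auto simp: min_def split: if_splits)
  qed
  with le show ?thesis by blast
qed

text \<open>\<open>P\<close> is a positive set of maximal value, the union of a maximising sequence.
  If a set disjoint from \<open>P\<close> had positive value, it would contain a positive set of
  positive value, and adjoining that to \<open>P\<close> would exceed the maximum.\<close>

lemma Hahn_decomposition:
  assumes \<omega>: "\<omega> \<in> finite_signed_measures"
  obtains P where "P \<in> sets borel" "\<And>A. A \<in> sets borel \<Longrightarrow> A \<subseteq> P \<Longrightarrow> 0 \<le> \<omega> A"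
    "\<And>A. A \<in> sets borel \<Longrightarrow> A \<inter> P = {} \<Longrightarrow> \<omega> A \<le> 0"
proof -
  let ?S = "Collect (positive_set \<omega>)"
  have "{} \<in> ?S" using fsm_empty[OF \<omega>] by (auto simp: positive_set_def)
  then have "\<exists>P\<in>?S. \<forall>A\<in>?S. min (real n) (\<omega> A) - 1 / real (Suc n) \<le> \<omega> P" for n
    by (intro exists_almost_maximal) auto
  then obtain Q where Q: "\<And>n. Q n \<in> ?S"
    "\<And>n A. A \<in> ?S \<Longrightarrow> min (real n) (\<omega> A) - 1 / real (Suc n) \<le> \<omega> (Q n)"
    by metis
  define P where "P = (\<Union>n. Q n)"
  have P: "positive_set \<omega> P"
    using positive_set_UN[OF \<omega>, of Q] Q by (auto simp: P_def)
  have max: "\<omega> A \<le> \<omega> P" if A: "positive_set \<omega> A" for A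
  proof (rule LIMSEQ_le_const2)
    show "(\<lambda>n. \<omega> A - 1 / real (Suc n)) \<longlonglongrightarrow> \<omega> A"
      using tendsto_diff[OF tendsto_const[of "\<omega> A"] LIMSEQ_Suc[OF lim_1_over_n[where 'a=real]]] by simp
    \<comment> \<open>From \<open>N\<close> on the truncation does not affect
      \<open>A\<close>.\<close>
    obtain N where N: "\<omega> A \<le> real N" using real_arch_simple by blast
    show "\<exists>N. \<forall>n\<ge>N. \<omega> A - 1 / real (Suc n) \<le> \<omega> P"
    proof (intro exI allI impI)
      fix n assume "N \<le> n"
      then have "min (real n) (\<omega> A) = \<omega> A" using N by auto
      moreover have "\<omega> (Q n) \<le> \<omega> P"
        using Q(1)[of n] by (intro positive_set_mono[OF \<omega> P]) (auto simp: P_def positive_set_def)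
      ultimately show "\<omega> A - 1 / real (Suc n) \<le> \<omega> P"
        using Q(2)[of A n] A by simp
    qed
  qed
  show ?thesis
  proof (rule that)
    show Pm: "P \<in> sets borel" and "\<And>A. A \<in> sets borel \<Longrightarrow> A \<subseteq> P \<Longrightarrow> 0 \<le> \<omega> A"
      using P unfolding positive_set_def by blast+
    fix A :: "'a set" assume A: "A \<in> sets borel" "A \<inter> P = {}"
    from exists_positive_subset[OF \<omega> A(1)] obtain B
      where B: "B \<subseteq> A" "positive_set \<omega> B" "\<omega> A \<le> \<omega> B" by blast
    have "\<omega> (P \<union> B) = \<omega> P + \<omega> B"
      using A B Pm by (intro fsm_Un \<omega>) (auto simp: positive_set_def)
    then show "\<omega> A \<le> 0"
      using max[OF positive_set_Un[OF \<omega> P B(2)]] B(3) by simp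
  qed
qed

text \<open>With a Hahn set \<open>P\<close>, the supremum in the variation is attained by splitting
  \<open>A\<close> into \<open>A \<inter> P\<close> and \<open>A - P\<close>. The set functions in
  the definitions of the two parts then reduce to \<open>\<omega> (A \<inter> P)\<close> and
  \<open>- \<omega> (A - P)\<close>, which are countably additive.\<close>

lemma Jordan_decomposition:
  assumes \<omega>: "\<omega> \<in> finite_signed_measures"
  obtains P where "P \<in> sets borel"
    "\<And>A. A \<in> sets borel \<Longrightarrow> 0 \<le> \<omega> (A \<inter> P)" "\<And>A. A \<in> sets borel \<Longrightarrow> \<omega> (A - P) \<le> 0"
    "\<And>A. A \<in> sets borel \<Longrightarrow> variation \<omega> A = ennreal (\<omega> (A \<inter> P) - \<omega> (A - P))"
    "\<And>A. A \<in> sets borel \<Longrightarrow> emeasure (pos_part_measure \<omega>) A = ennreal (\<omega> (A \<inter> P))"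
    "\<And>A. A \<in> sets borel \<Longrightarrow> emeasure (neg_part_measure \<omega>) A = ennreal (- \<omega> (A - P))"
proof -
  obtain P where P: "P \<in> sets borel" "\<And>A. A \<in> sets borel \<Longrightarrow> A \<subseteq> P \<Longrightarrow> 0 \<le> \<omega> A"
    "\<And>A. A \<in> sets borel \<Longrightarrow> A \<inter> P = {} \<Longrightarrow> \<omega> A \<le> 0"
    using Hahn_decomposition[OF \<omega>] by metis
  have p: "0 \<le> \<omega> (A \<inter> P)" and n: "\<omega> (A - P) \<le> 0" if "A \<in> sets borel" for A
    using that P(1) P(2)[of "A \<inter> P"] P(3)[of "A - P"] by (simp_all add: Int_commute)
  have split: "\<omega> A = \<omega> (A \<inter> P) + \<omega> (A - P)" if "A \<in> sets borel" for A
    using fsm_Un[OF \<omega>, of "A \<inter> P" "A - P"] that P(1) by (simp add: Int_Diff_Un Int_Diff_disjoint)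
  let ?v = "\<lambda>A. \<omega> (A \<inter> P) - \<omega> (A - P)"
  have var: "variation \<omega> A = ennreal (?v A)" if A: "A \<in> sets borel" for A
    unfolding variation_def
  proof (intro antisym SUP_least)
    fix Q assume "Q \<in> {Q. finite Q \<and> Q \<subseteq> sets borel \<and> partition_on A Q}"
    then have Q: "finite Q" "Q \<subseteq> sets borel" "\<Union>Q = A" "disjoint Q"
      by (auto simp: partition_on_def)
    have "(\<Sum>B\<in>Q. ennreal \<bar>\<omega> B\<bar>) \<le> (\<Sum>B\<in>Q. ennreal (?v B))"
    proof (intro sum_mono ennreal_leI)
      fix B assume "B \<in> Q"
      then have "B \<in> sets borel" using Q by auto
      then show "\<bar>\<omega> B\<bar> \<le> ?v B" using p[of B] n[of B] split[of B] by linarith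
    qed
    also have "\<dots> = ennreal (\<Sum>B\<in>Q. ?v B)"
    proof (intro sum_ennreal)
      fix B assume "B \<in> Q"
      then have "B \<in> sets borel" using Q by auto
      then show "0 \<le> ?v B" using p[of B] n[of B] by linarith
    qed
    also have "(\<Sum>B\<in>Q. ?v B) = ?v A"
    proof -
      have aux: "(\<Sum>B\<in>Q. \<omega> (B \<inter> X)) = \<omega> (A \<inter> X)" if X: "X \<in> sets borel" for X
      proof -
        \<comment> \<open>Distinct members of \<open>Q\<close> can have the same trace on
          \<open>X\<close> only if that trace is empty, where \<open>\<omega>\<close>
          vanishes.\<close>
        have "(\<Sum>B\<in>Q. \<omega> (B \<inter> X)) = sum \<omega> ((\<lambda>B. B \<inter> X) ` Q)"
        proof (subst sum.reindex_nontrivial[OF Q(1)])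
          fix B B' assume "B \<in> Q" "B' \<in> Q" "B \<noteq> B'" "B \<inter> X = B' \<inter> X"
          then have "B \<inter> X = {}" using Q(4) unfolding disjoint_def by blast
          then show "\<omega> (B \<inter> X) = 0" using fsm_empty[OF \<omega>] by simp
        qed (auto simp: o_def)
        also have "\<dots> = \<omega> (\<Union>((\<lambda>B. B \<inter> X) ` Q))"
          using Q X by (intro fsm_sum[symmetric] \<omega>) (auto simp: disjoint_def)
        also have "\<Union>((\<lambda>B. B \<inter> X) ` Q) = A \<inter> X" using Q(3) by auto
        finally show ?thesis .
      qed
      show ?thesis
        using aux[OF P(1)] aux[of "- P"] P(1) by (simp add: sum_subtractf Diff_eq)
    qed
    finally show "(\<Sum>B\<in>Q. ennreal \<bar>\<omega> B\<bar>) \<le> ennreal (?v A)" .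
  next
    \<comment> \<open>Cells of a partition are nonempty, so an empty half has to be dropped.\<close>
    let ?Q = "{A \<inter> P, A - P} - {{}}"
    have "partition_on A ?Q" by (auto simp: partition_on_def disjoint_def)
    then have Q: "?Q \<in> {Q. finite Q \<and> Q \<subseteq> sets borel \<and> partition_on A Q}"
      using A P(1) by auto
    \<comment> \<open>The two halves coincide only if both are empty; then the sum has a single
      term, which is 0.\<close>
    have "ennreal (?v A) = ennreal (\<Sum>B\<in>{A \<inter> P, A - P}. \<bar>\<omega> B\<bar>)"
    proof (cases "A \<inter> P = A - P")
      case True
      then have e: "A \<inter> P = {}" "A - P = {}" by auto
      show ?thesis unfolding e using fsm_empty[OF \<omega>] by simp
    next
      case False
      then show ?thesis using p[OF A] n[OF A] by simp
    qed
    also have "(\<Sum>B\<in>{A \<inter> P, A - P}. \<bar>\<omega> B\<bar>) = (\<Sum>B\<in>?Q. \<bar>\<omega> B\<bar>)"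
      using fsm_empty[OF \<omega>] by (intro sum.mono_neutral_right) auto
    also have "ennreal \<dots> = (\<Sum>B\<in>?Q. ennreal \<bar>\<omega> B\<bar>)"
      by (simp add: sum_ennreal)
    also have "\<dots> \<le> (SUP Q\<in>{Q. finite Q \<and> Q \<subseteq> sets borel \<and> partition_on A Q}.
        \<Sum>B\<in>Q. ennreal \<bar>\<omega> B\<bar>)"
      using Q by (rule SUP_upper)
    finally show "ennreal (?v A) \<le> \<dots>" .
  qed
  \<comment> \<open>Shared by both parts. \<open>measure_of\<close> yields the zero measure unless
    the given set function is a measure, so countable additivity must be established before values
    can be read off.\<close>
  have pm: "emeasure (measure_of UNIV (sets borel) f) A = ennreal (\<omega>' A)"
    if f: "\<And>A. A \<in> sets borel \<Longrightarrow> f A = ennreal (\<omega>' A)" and A: "A \<in> sets borel"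
      and nn: "\<And>A. A \<in> sets borel \<Longrightarrow> 0 \<le> \<omega>' A" and z: "\<omega>' {} = 0"
      and ca: "\<And>F. (\<And>n. F n \<in> sets borel) \<Longrightarrow> disjoint_family F \<Longrightarrow> (\<lambda>n::nat. \<omega>' (F n)) sums \<omega>' (\<Union>n. F n)"
    for A f and \<omega>' :: "'a set \<Rightarrow> real"
  proof -
    have "emeasure (measure_of UNIV (sets borel) f) A = f A"
    proof (rule emeasure_measure_of_sigma)
      show "sigma_algebra UNIV (sets (borel :: 'a measure))"
        using sets.sigma_algebra_axioms[of "borel :: 'a measure"] by simp
      show "positive (sets borel) f"
        using f z by (simp add: positive_def)
      show "countably_additive (sets borel) f"
        unfolding countably_additive_def
      proof (intro allI impI)
        fix F :: "nat \<Rightarrow> 'a set"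
        assume F: "range F \<subseteq> sets borel" "disjoint_family F"
        then have Fm: "F n \<in> sets borel" for n by auto
        have "(\<Sum>n. f (F n)) = (\<Sum>n. ennreal (\<omega>' (F n)))" using f Fm by simp
        also have "\<dots> = ennreal (\<omega>' (\<Union>n. F n))"
          using nn Fm F ca by (intro suminf_ennreal_eq) auto
        finally show "(\<Sum>n. f (F n)) = f (\<Union>n. F n)" using f Fm by auto
      qed
    qed (use A in auto)
    then show ?thesis using f A by simp
  qed
  have v0: "enn2real (variation \<omega> A) = ?v A" if "A \<in> sets borel" for A
    using var[OF that] p[OF that] n[OF that] by simp
  have half: "(enn2real (variation \<omega> A) + \<omega> A) / 2 = \<omega> (A \<inter> P)"
    "(enn2real (variation \<omega> A) - \<omega> A) / 2 = - \<omega> (A - P)" if "A \<in> sets borel" for A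
    using v0[OF that] split[OF that] by (simp_all only:) (simp_all add: field_simps)
  have ca: "(\<lambda>n. \<omega> (F n \<inter> X)) sums \<omega> ((\<Union>n. F n) \<inter> X)"
    if "\<And>n::nat. F n \<in> sets borel" "disjoint_family F" "X \<in> sets borel" for F X
  proof -
    have "(\<lambda>n. \<omega> (F n \<inter> X)) sums \<omega> (\<Union>n. F n \<inter> X)"
      using that by (intro fsm_sums \<omega>) (auto simp: disjoint_family_on_def)
    then show ?thesis by simp
  qed
  show ?thesis
  proof (rule that[OF P(1) p n var])
    show "emeasure (pos_part_measure \<omega>) A = ennreal (\<omega> (A \<inter> P))" if "A \<in> sets borel" for A
      unfolding pos_part_measure_def
      by (intro pm[where \<omega>'="\<lambda>A. \<omega> (A \<inter> P)"] arg_cong[of _ _ ennreal] half that p ca P(1))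
        (simp_all add: fsm_empty[OF \<omega>])
    show "emeasure (neg_part_measure \<omega>) A = ennreal (- \<omega> (A - P))" if "A \<in> sets borel" for A
      unfolding neg_part_measure_def
    proof (intro pm[where \<omega>'="\<lambda>A. - \<omega> (A - P)"] arg_cong[of _ _ ennreal] half that)
      show "(\<lambda>n. - \<omega> (F n - P)) sums - \<omega> ((\<Union>n. F n) - P)"
        if "\<And>n::nat. F n \<in> sets borel" "disjoint_family F" for F
        using sums_minus[OF ca[OF that, of "- P"]] P(1) by (simp only: Diff_eq) auto
    qed (use n fsm_empty[OF \<omega>] in auto)
  qed
qed

section \<open>Rotations and circle means\<close>

definition complex_of_vec :: "real^2 \<Rightarrow> complex" where
  "complex_of_vec x = Complex (x $ 1) (x $ 2)"

definition vec_of_complex :: "complex \<Rightarrow> real^2" where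
  "vec_of_complex z = vector [Re z, Im z]"

lemma complex_of_vec_inverse [simp]: "vec_of_complex (complex_of_vec x) = x"
  by (simp add: vec_of_complex_def complex_of_vec_def vec_eq_iff forall_2)

lemma vec_of_complex_inverse [simp]: "complex_of_vec (vec_of_complex z) = z"
  by (simp add: vec_of_complex_def complex_of_vec_def)

lemma complex_of_vec_add: "complex_of_vec (x + y) = complex_of_vec x + complex_of_vec y"
  and complex_of_vec_diff: "complex_of_vec (x - y) = complex_of_vec x - complex_of_vec y"
  by (simp_all add: complex_of_vec_def complex_eq_iff)

lemma norm_complex_of_vec [simp]: "norm (complex_of_vec x) = norm x"
  by (simp add: complex_of_vec_def norm_vec_def L2_set_def sum_2 cmod_def)

lemma norm_vec_of_complex [simp]: "norm (vec_of_complex z) = norm z"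
  using norm_complex_of_vec[of "vec_of_complex z"] by simp

lemma bounded_linear_complex_of_vec: "bounded_linear complex_of_vec"
  by (rule bounded_linear_intro[where K=1])
    (simp_all add: complex_of_vec_add, simp add: complex_of_vec_def complex_eq_iff)

lemma bounded_linear_vec_of_complex: "bounded_linear vec_of_complex"
  by (rule bounded_linear_intro[where K=1])
    (simp_all, simp_all add: vec_of_complex_def vec_eq_iff forall_2)

lemma measurable_complex_of_vec [measurable]: "complex_of_vec \<in> borel_measurable borel"
  by (intro borel_measurable_continuous_onI linear_continuous_on bounded_linear_complex_of_vec)

lemma measurable_vec_of_complex [measurable]: "vec_of_complex \<in> borel_measurable borel"
  by (intro borel_measurable_continuous_onI linear_continuous_on bounded_linear_vec_of_complex)

text \<open>Preimages of boxes are boxes with the same side lengths, and the values on boxes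
  determine Lebesgue measure.\<close>

lemma lborel_distr_complex_of_vec: "distr lborel borel complex_of_vec = lborel"
proof (rule lborel_eqI[symmetric])
  fix l u :: complex
  assume le: "\<And>b. b \<in> Basis \<Longrightarrow> l \<bullet> b \<le> u \<bullet> b"
  have B: "(Basis :: (real^2) set) = {axis 1 1, axis 2 1}"
    by (auto simp: Basis_vec_def UNIV_2)
  have ax: "axis 1 (1::real) \<noteq> (axis 2 1 :: real^2)"
    by (simp add: axis_eq_axis)
  have le': "Re l \<le> Re u" "Im l \<le> Im u"
    using le[of 1] le[of \<i>] by (auto simp: Basis_complex_def)
  have "complex_of_vec -` box l u = box (vec_of_complex l) (vec_of_complex u)"
    by (auto simp: box_def B inner_axis Basis_complex_def complex_of_vec_def vec_of_complex_def)
  then have "emeasure (distr lborel borel complex_of_vec) (box l u)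
      = emeasure lborel (box (vec_of_complex l) (vec_of_complex u))"
    by (simp add: emeasure_distr)
  also have "\<dots> = ennreal (\<Prod>b\<in>Basis. (vec_of_complex u - vec_of_complex l) \<bullet> b)"
    by (rule emeasure_lborel_box) (use le' in \<open>auto simp: B inner_axis vec_of_complex_def\<close>)
  also have "\<dots> = ennreal (\<Prod>b\<in>Basis. (u - l) \<bullet> b)"
    using ax by (simp add: B Basis_complex_def inner_axis vec_of_complex_def)
  finally show "emeasure (distr lborel borel complex_of_vec) (box l u) = (\<Prod>b\<in>Basis. (u - l) \<bullet> b)" .
qed simp

text \<open>Orthogonal maps of \<open>real^2\<close> preserve Lebesgue measure; the identification
  with the complex plane carries this over, and it suffices to look at boxes.\<close>

lemma lborel_distr_rotation:
  fixes w :: complex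
  assumes w: "norm w = 1"
  shows "distr lborel borel (\<lambda>z. w * z) = lborel"
proof (rule lborel_eqI[symmetric])
  fix l u :: complex
  assume le: "\<And>b. b \<in> Basis \<Longrightarrow> l \<bullet> b \<le> u \<bullet> b"
  let ?S = "complex_of_vec -` box l u"
  \<comment> \<open>The inverse rotation, read in \<open>real^2\<close>: preimages under
    multiplication by \<open>w\<close> become images under \<open>?R\<close>.\<close>
  let ?R = "\<lambda>x. vec_of_complex (cnj w * complex_of_vec x)"
  have cw: "cnj w * w = 1" "w * cnj w = 1"
    using w by (simp_all add: complex_norm_square[symmetric] mult.commute)
  have cw': "cnj w * (w * z) = z" "w * (cnj w * z) = z" for z
    using cw by (simp_all flip: mult.assoc)
  have "linear ?R"
    using linear_compose[OF linear_compose[OF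
        bounded_linear.linear[OF bounded_linear_complex_of_vec]
        bounded_linear.linear[OF bounded_linear_mult_right[of "cnj w"]]]
        bounded_linear.linear[OF bounded_linear_vec_of_complex]]
    by (simp add: o_def)
  then have orth: "orthogonal_transformation ?R"
    by (simp add: orthogonal_transformation norm_mult w)
  have im: "complex_of_vec -` ((\<lambda>z. w * z) -` box l u) = ?R ` ?S"
  proof safe
    fix x assume "w * complex_of_vec x \<in> box l u"
    then show "x \<in> ?R ` ?S"
      by (intro image_eqI[of _ _ "vec_of_complex (w * complex_of_vec x)"]) (simp_all add: cw')
  qed (simp add: cw')
  have box: "emeasure lborel ?S = emeasure lborel (box l u)"
    by (subst lborel_distr_complex_of_vec[symmetric]) (simp add: emeasure_distr)
  have Sm: "?S \<in> sets lborel"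
    using measurable_sets_borel[OF measurable_complex_of_vec borel_open[OF open_box]] by simp
  have fin: "emeasure lborel ?S < \<infinity>"
    unfolding box using emeasure_lborel_box_finite[of l u] by simp
  have Sl: "?S \<in> lmeasurable"
    using Sm fin by (intro fmeasurableI) auto
  have Rm: "?R ` ?S \<in> sets lborel"
  proof -
    have "(\<lambda>x. w * complex_of_vec x) -` box l u \<inter> space borel \<in> sets borel"
      by (rule measurable_sets[of _ borel borel]) (simp_all add: borel_open open_box)
    then show ?thesis
      unfolding im[symmetric] by (simp add: vimage_def)
  qed
  have "(\<lambda>z. w * z) -` box l u \<inter> space borel \<in> sets borel"
    by (rule measurable_sets[of _ borel borel]) (simp_all add: borel_open open_box)
  then have Tm: "(\<lambda>z. w * z) -` box l u \<in> sets borel" by simp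
  have "emeasure (distr lborel borel (\<lambda>z. w * z)) (box l u)
      = emeasure lborel ((\<lambda>z. w * z) -` box l u)"
    by (simp add: emeasure_distr)
  also have "\<dots> = emeasure lborel (?R ` ?S)"
    by (subst lborel_distr_complex_of_vec[symmetric], subst emeasure_distr) (simp_all add: im Tm)
  also have "\<dots> = emeasure lebesgue (?R ` ?S)"
    using Rm by simp
  also have "\<dots> = emeasure lebesgue ?S"
    unfolding emeasure_eq_measure2[OF measurable_orthogonal_image[OF orth Sl]]
      emeasure_eq_measure2[OF Sl] measure_orthogonal_image[OF orth Sl] ..
  also have "\<dots> = emeasure lborel (box l u)"
    using Sm box by simp
  also have "\<dots> = ennreal (\<Prod>b\<in>Basis. (u - l) \<bullet> b)"
    using le by (rule emeasure_lborel_box)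
  finally show "emeasure (distr lborel borel (\<lambda>z. w * z)) (box l u) = (\<Prod>b\<in>Basis. (u - l) \<bullet> b)" .
qed simp

section \<open>Means over the unit circle, with normalised arc length as a measure on the
  plane\<close>

definition circle_measure :: "complex measure" where
  "circle_measure = distr (density lborel (\<lambda>t. ennreal (indicator {0..2 * pi} t / (2 * pi)))) borel cis"

lemma measurable_cis [measurable]: "cis \<in> borel_measurable borel"
  by (intro borel_measurable_continuous_onI continuous_intros)

lemma sets_circle_measure [measurable_cong, simp]: "sets circle_measure = sets borel"
  by (simp add: circle_measure_def)

lemma space_circle_measure [simp]: "space circle_measure = UNIV"
  by (simp add: circle_measure_def)

lemma measurable_cnj [measurable]: "cnj \<in> borel_measurable borel"
  by (intro borel_measurable_continuous_onI continuous_intros)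

lemma emeasure_circle_measure_UNIV: "emeasure circle_measure UNIV = 1"
proof -
  have "(\<integral>\<^sup>+t. ennreal (indicator {0..2 * pi} t / (2 * pi)) \<partial>lborel)
      = (\<integral>\<^sup>+t. ennreal (1 / (2 * pi)) * indicator {0..2 * pi} t \<partial>lborel)"
    by (intro nn_integral_cong) (auto split: split_indicator)
  also have "\<dots> = 1"
    by (simp add: nn_integral_cmult_indicator flip: ennreal_mult)
  finally show ?thesis
    by (simp add: circle_measure_def emeasure_distr emeasure_density)
qed

interpretation circle: finite_measure circle_measure
  by (rule finite_measureI) (simp add: emeasure_circle_measure_UNIV)

lemma AE_circle_measure: "AE z in circle_measure. norm z = 1"
  unfolding circle_measure_def by (subst AE_distr_iff) auto

text \<open>The mean value property, from Cauchy's formula at the centre. Only the values of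
  \<open>g\<close> on the circle count, so \<open>g\<close> may involve conjugates as long as it
  agrees there with a holomorphic function.\<close>

lemma integral_circle_measure:
  fixes f :: "complex \<Rightarrow> complex"
  assumes f: "f holomorphic_on cball 0 1" and [measurable]: "g \<in> borel_measurable borel"
    and fg: "\<And>z. norm z = 1 \<Longrightarrow> g z = f z"
  shows "integral\<^sup>L circle_measure g = f 0"
proof -
  have "((\<lambda>u. f u / (u - 0)) has_contour_integral 2 * complex_of_real pi * \<i> * f 0) (circlepath 0 1)"
    by (rule Cauchy_integral_circlepath_simple[OF f]) simp
  \<comment> \<open>The contour integral is rewritten over the angle, the parameter of
    \<open>circle_measure\<close>.\<close>
  then have "((\<lambda>t. f (cis t) / cis t * \<i> * cis t) has_integral 2 * complex_of_real pi * \<i> * f 0) {0..2 * pi}"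
    unfolding circlepath_def by (subst (asm) has_contour_integral_part_circlepath_iff) simp_all
  then have "((\<lambda>t. (f (cis t) * \<i>)) has_integral 2 * complex_of_real pi * \<i> * f 0) {0..2 * pi}"
    by (simp add: field_simps)
  from has_integral_mult_right[OF this, of "1 / (2 * pi * \<i>)"]
  have hi: "((\<lambda>t. f (cis t) / (2 * pi)) has_integral f 0) {0..2 * pi}"
    by (simp add: field_simps)
  have "continuous_on {0..2 * pi} (\<lambda>t. f (cis t))"
    by (rule continuous_on_compose2[OF holomorphic_on_imp_continuous_on[OF f]])
      (auto intro!: continuous_intros)
  then have si: "set_integrable lborel {0..2 * pi} (\<lambda>t. f (cis t) / (2 * pi))"
    unfolding set_integrable_def
    by (intro borel_integrable_compact) (auto intro!: continuous_intros)
  have "integral\<^sup>L circle_measure g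
      = (\<integral>t. (indicator {0..2 * pi} t / (2 * pi)) *\<^sub>R g (cis t) \<partial>lborel)"
    unfolding circle_measure_def
    by (subst integral_distr) (simp_all add: integral_density)
  also have "\<dots> = (LINT t:{0..2 * pi}|lborel. f (cis t) / (2 * pi))"
    unfolding set_lebesgue_integral_def
    by (intro Bochner_Integration.integral_cong)
      (auto simp: fg scaleR_conv_of_real split: split_indicator)
  also have "\<dots> = f 0"
    using set_borel_integral_eq_integral(2)[OF si] integral_unique[OF hi] by simp
  finally show ?thesis .
qed

text \<open>The integrand has no pole in the closed unit disc, so its mean is the value at the
  centre.\<close>

lemma circle_mean_inverse_inside:
  assumes "norm a < norm p"
  shows "integral\<^sup>L circle_measure (\<lambda>z. inverse (p + z * a)) = inverse p"
proof -
  have nz: "p + z * a \<noteq> 0" if "norm z \<le> 1" for z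
  proof
    assume "p + z * a = 0"
    then have "norm p = norm z * norm a"
      by (metis add_eq_0_iff norm_minus_cancel norm_mult)
    also have "\<dots> \<le> 1 * norm a" using that by (intro mult_right_mono) auto
    finally show False using assms by simp
  qed
  have "integral\<^sup>L circle_measure (\<lambda>z. inverse (p + z * a)) = inverse (p + 0 * a)"
    by (rule integral_circle_measure) (use nz in \<open>auto intro!: holomorphic_intros\<close>)
  then show ?thesis by simp
qed

text \<open>Here the pole may lie inside the disc. On the circle \<open>cnj z = inverse z\<close>,
  so the conjugate of the integrand equals \<open>z / (cnj a + z * cnj p)\<close>, which is
  holomorphic on the disc and vanishes at the centre.\<close>

lemma circle_mean_inverse_outside:
  assumes "norm p < norm a"
  shows "integral\<^sup>L circle_measure (\<lambda>z. inverse (p + z * a)) = 0"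
proof -
  have nz: "cnj a + z * cnj p \<noteq> 0" if "norm z \<le> 1" for z
  proof
    assume "cnj a + z * cnj p = 0"
    then have "norm a = norm z * norm p"
      by (metis add_eq_0_iff norm_minus_cancel norm_mult complex_mod_cnj)
    also have "\<dots> \<le> 1 * norm p" using that by (intro mult_right_mono) auto
    finally show False using assms by simp
  qed
  have J: "integral\<^sup>L circle_measure (\<lambda>z. cnj (inverse (p + z * a)))
      = (\<lambda>z. z / (cnj a + z * cnj p)) 0"
  proof (rule integral_circle_measure)
    fix z :: complex assume z: "norm z = 1"
    then have zz: "z * cnj z = 1" by (simp add: complex_norm_square[symmetric])
    have "z * (cnj p + cnj z * cnj a) = z * cnj p + (z * cnj z) * cnj a"
      by (simp add: algebra_simps)
    then have "cnj a + z * cnj p = z * (cnj p + cnj z * cnj a)"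
      by (simp add: zz)
    moreover have "z \<noteq> 0" using z by auto
    ultimately show "cnj (inverse (p + z * a)) = z / (cnj a + z * cnj p)"
      by (simp add: inverse_eq_divide)
  qed (use nz in \<open>auto intro!: holomorphic_intros\<close>)
  have "cnj (integral\<^sup>L circle_measure (\<lambda>z. inverse (p + z * a)))
      = integral\<^sup>L circle_measure (\<lambda>z. cnj (inverse (p + z * a)))"
    by (rule Bochner_Integration.integral_cnj[symmetric])
  also have "\<dots> = 0" unfolding J by simp
  finally show ?thesis by (simp only: complex_cnj_zero_iff)
qed

text \<open>Every rotated copy of \<open>g\<close> has the same integral; averaging over the
  rotations and exchanging the integrals gives the claim.\<close>

lemma integral_rotation_average:
  fixes g :: "complex \<Rightarrow> complex"
  assumes g: "integrable lborel g"
  shows "integral\<^sup>L lborel g = (\<integral>v. (\<integral>z. g (z * v) \<partial>circle_measure) \<partial>lborel)"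
proof -
  have [measurable]: "g \<in> borel_measurable borel" using g by auto
  interpret P: pair_sigma_finite circle_measure "lborel :: complex measure" ..
  have rot: "(\<integral>\<^sup>+v. norm (g (z * v)) \<partial>lborel) = (\<integral>\<^sup>+v. norm (g v) \<partial>lborel)"
    "(\<integral>v. g (z * v) \<partial>lborel) = (\<integral>v. g v \<partial>lborel)" if "norm z = 1" for z
    by (subst (2) lborel_distr_rotation[OF that, symmetric], simp add: nn_integral_distr integral_distr)+
  have "integrable (circle_measure \<Otimes>\<^sub>M lborel) (\<lambda>(z, v). g (z * v))"
  proof (rule integrableI_bounded)
    have "(\<integral>\<^sup>+p. ennreal (norm (case p of (z, v) \<Rightarrow> g (z * v))) \<partial>(circle_measure \<Otimes>\<^sub>M lborel))
        = (\<integral>\<^sup>+z. (\<integral>\<^sup>+v. norm (g (z * v)) \<partial>lborel) \<partial>circle_measure)"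
      by (subst lborel.nn_integral_fst[symmetric]) simp_all
    also have "\<dots> = (\<integral>\<^sup>+z. (\<integral>\<^sup>+v. norm (g v) \<partial>lborel) \<partial>circle_measure)"
      using AE_circle_measure by (intro nn_integral_cong_AE) (auto simp: rot)
    also have "\<dots> < \<infinity>"
      using g emeasure_circle_measure_UNIV by (simp add: integrable_iff_bounded)
    finally show "(\<integral>\<^sup>+p. ennreal (norm (case p of (z, v) \<Rightarrow> g (z * v))) \<partial>(circle_measure \<Otimes>\<^sub>M lborel)) < \<infinity>" .
  qed simp
  from P.Fubini_integral[OF this]
  have "(\<integral>v. (\<integral>z. g (z * v) \<partial>circle_measure) \<partial>lborel) = (\<integral>z. (\<integral>v. g (z * v) \<partial>lborel) \<partial>circle_measure)"
    by simp
  also have "\<dots> = (\<integral>z. (\<integral>v. g v \<partial>lborel) \<partial>circle_measure)"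
    using AE_circle_measure by (intro integral_cong_AE) (auto simp: rot)
  also have "\<dots> = integral\<^sup>L lborel g"
    by (simp add: measure_def emeasure_circle_measure_UNIV)
  finally show ?thesis ..
qed

text \<open>Layer-cake argument: for \<open>0 < dist x y < 1\<close> the kernel is 1 plus the
  integral of \<open>d * t powr (-d - 1)\<close> over \<open>t\<close> from \<open>dist x y\<close>
  to 1. After exchanging the integrals the growth bound on \<open>cball x t\<close> leaves
  \<open>A * d * t powr (a - d - 1)\<close>, which is integrable at 0 because
  \<open>d < a\<close>.\<close>

lemma riesz_potential_bound:
  fixes N :: "complex measure"
  assumes "sigma_finite_measure N" and [measurable_cong]: "sets N = sets borel"
    and "0 \<le> A" "0 < d" "d < a"
    and N: "\<And>t. 0 < t \<Longrightarrow> t \<le> 1 \<Longrightarrow> emeasure N (cball x t) \<le> ennreal (A * t powr a)"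
  shows "(\<integral>\<^sup>+y. ennreal (dist x y powr (-d)) * indicator (ball x 1) y \<partial>N)
    \<le> ennreal (A + A * d / (a - d))"
proof -
  interpret sigma_finite_measure N by fact
  interpret P: pair_sigma_finite N "lborel :: real measure" ..
  have [measurable]: "cball x t \<in> sets N" "ball x t \<in> sets N" for t
    by (simp_all add: assms(2))
  let ?k = "\<lambda>y t. if dist x y \<le> t \<and> 0 < t \<and> t \<le> 1 then ennreal (d * t powr (-d - 1)) else 0"
  \<comment> \<open>At \<open>y = x\<close> the left side is 0, since
    \<open>0 powr (-d) = 0\<close>.\<close>
  have pw: "ennreal (dist x y powr (-d)) * indicator (ball x 1) y
      \<le> indicator (cball x 1) y + (\<integral>\<^sup>+t. ?k y t \<partial>lborel)" for y
  proof (cases "y \<in> ball x 1 \<and> y \<noteq> x")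
    case True
    define D where "D = dist x y"
    have D: "0 < D" "D < 1" using True by (auto simp: D_def)
    have "(\<integral>\<^sup>+t. ?k y t \<partial>lborel) = (\<integral>\<^sup>+t\<in>{D..1}. ennreal (d * t powr (-d - 1)) \<partial>lborel)"
      using D(1) by (intro nn_integral_cong) (auto simp: D_def[symmetric] split: split_indicator)
    \<comment> \<open>The antiderivative is \<open>- (t powr (-d))\<close>.\<close>
    also have "\<dots> = ennreal (- (1 powr (-d)) - - (D powr (-d)))"
      using D \<open>0 < d\<close>
      by (intro nn_integral_FTC_Icc) (auto intro!: derivative_eq_intros simp: field_simps)
    also have "\<dots> = ennreal (D powr (-d) - 1)" by simp
    finally have k: "(\<integral>\<^sup>+t. ?k y t \<partial>lborel) = ennreal (D powr (-d) - 1)" .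
    have "1 \<le> D powr (-d)"
      using powr_mono2'[of "-d" D 1] D \<open>0 < d\<close> by simp
    then have "ennreal (D powr (-d)) = 1 + ennreal (D powr (-d) - 1)"
      by (subst ennreal_1[symmetric], subst ennreal_plus[symmetric]) auto
    then show ?thesis using True k by (simp add: D_def)
  qed auto
  have "(\<integral>\<^sup>+y. ennreal (dist x y powr (-d)) * indicator (ball x 1) y \<partial>N)
      \<le> (\<integral>\<^sup>+y. indicator (cball x 1) y + (\<integral>\<^sup>+t. ?k y t \<partial>lborel) \<partial>N)"
    by (intro nn_integral_mono pw)
  also have "\<dots> = emeasure N (cball x 1) + (\<integral>\<^sup>+y. (\<integral>\<^sup>+t. ?k y t \<partial>lborel) \<partial>N)"
    by (subst nn_integral_add) auto
  also have "(\<integral>\<^sup>+y. (\<integral>\<^sup>+t. ?k y t \<partial>lborel) \<partial>N) = (\<integral>\<^sup>+t. (\<integral>\<^sup>+y. ?k y t \<partial>N) \<partial>lborel)"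
    by (rule P.Fubini'[symmetric]) measurable
  also have "\<dots> \<le> (\<integral>\<^sup>+t. ennreal (A * d * (t powr (a - d - 1))) * indicator {0..1} t \<partial>lborel)"
  proof (intro nn_integral_mono)
    fix t :: real
    show "(\<integral>\<^sup>+y. ?k y t \<partial>N) \<le> ennreal (A * d * (t powr (a - d - 1))) * indicator {0..1} t"
    proof (cases "0 < t \<and> t \<le> 1")
      case True
      then have "(\<integral>\<^sup>+y. ?k y t \<partial>N) = (\<integral>\<^sup>+y. ennreal (d * t powr (-d - 1)) * indicator (cball x t) y \<partial>N)"
        by (intro nn_integral_cong) (auto split: split_indicator)
      also have "\<dots> = ennreal (d * t powr (-d - 1)) * emeasure N (cball x t)"
        by (rule nn_integral_cmult_indicator) simp
      also have "\<dots> \<le> ennreal (d * t powr (-d - 1)) * ennreal (A * t powr a)"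
        using True by (intro mult_left_mono N) auto
      also have "\<dots> = ennreal (A * d * (t powr (a - d - 1)))"
        using True \<open>0 < d\<close> \<open>0 \<le> A\<close>
        by (simp flip: ennreal_mult powr_add add: mult_ac) (simp add: algebra_simps flip: powr_add)
      finally show ?thesis using True by simp
    qed auto
  qed
  also have "\<dots> = ennreal (A * d * (1 powr (a - d - 1 + 1) / (a - d - 1 + 1)))"
  proof -
    have "((\<lambda>t. A * d * t powr (a - d - 1)) has_integral A * d * (1 powr (a - d - 1 + 1) / (a - d - 1 + 1))) {0..1}"
      using assms(5) by (intro has_integral_mult_right has_integral_powr_from_0) auto
    then have "((\<lambda>t. if t \<in> {0..1} then A * d * t powr (a - d - 1) else 0) has_integral
        A * d * (1 powr (a - d - 1 + 1) / (a - d - 1 + 1))) UNIV"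
      by (simp only: has_integral_restrict_UNIV)
    from nn_integral_has_integral_lborel[OF _ _ this]
    have "(\<integral>\<^sup>+t. ennreal (if t \<in> {0..1} then A * d * t powr (a - d - 1) else 0) \<partial>lborel)
        = ennreal (A * d * (1 powr (a - d - 1 + 1) / (a - d - 1 + 1)))"
      using \<open>0 < d\<close> \<open>0 \<le> A\<close> by simp
    moreover have "(\<integral>\<^sup>+t. ennreal (A * d * (t powr (a - d - 1))) * indicator {0..1} t \<partial>lborel)
        = (\<integral>\<^sup>+t. ennreal (if t \<in> {0..1} then A * d * t powr (a - d - 1) else 0) \<partial>lborel)"
      by (intro nn_integral_cong) auto
    ultimately show ?thesis by (simp only:)
  qed
  also have "emeasure N (cball x 1) + \<dots> \<le> ennreal A + ennreal (A * d / (a - d))"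
    using N[of 1] by (intro add_mono) auto
  also have "\<dots> = ennreal (A + A * d / (a - d))"
    using assms by (intro ennreal_plus[symmetric]) auto
  finally show ?thesis by (simp add: add_left_mono)
qed

section \<open>Potentials of measures with power growth\<close>

lemma measurable_balls [measurable]:
  fixes c :: "'a::metric_space"
  shows "ball c r \<in> sets borel" "cball c r \<in> sets borel"
  by simp_all

lemma nn_integral_lborel_translate:
  fixes c :: "'a::euclidean_space"
  assumes [measurable]: "g \<in> borel_measurable borel"
  shows "(\<integral>\<^sup>+x. g (c + x) \<partial>lborel) = (\<integral>\<^sup>+x. g x \<partial>lborel)"
  by (subst (2) lborel_distr_plus[of c, symmetric]) (simp add: nn_integral_distr)

lemma integral_lborel_translate:
  fixes c :: "'a::euclidean_space" and g :: "'a \<Rightarrow> 'b::{banach, second_countable_topology}"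
  assumes [measurable]: "g \<in> borel_measurable borel"
  shows "(\<integral>x. g (c + x) \<partial>lborel) = (\<integral>x. g x \<partial>lborel)"
  by (subst (2) lborel_distr_plus[of c, symmetric]) (simp add: integral_distr)

lemma emeasure_lborel_ball_complex: "0 \<le> r \<Longrightarrow> emeasure lborel (ball (c::complex) r) = ennreal (pi * r\<^sup>2)"
  and emeasure_lborel_cball_complex: "0 \<le> r \<Longrightarrow> emeasure lborel (cball (c::complex) r) = ennreal (pi * r\<^sup>2)"
  by (simp_all add: emeasure_ball emeasure_cball unit_ball_vol_2)

lemma measure_lborel_ball_complex: "0 \<le> r \<Longrightarrow> measure lborel (ball (c::complex) r) = pi * r\<^sup>2"
  by (simp add: measure_def emeasure_lborel_ball_complex)

lemma riesz_potential_lborel: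
  fixes x :: complex
  assumes "0 < d" "d < 2"
  shows "(\<integral>\<^sup>+y. ennreal (dist x y powr (-d)) * indicator (ball x 1) y \<partial>lborel)
    \<le> ennreal (pi + pi * d / (2 - d))"
  by (rule riesz_potential_bound)
    (use assms in \<open>auto simp: emeasure_lborel_cball_complex sigma_finite_lborel powr_numeral\<close>)

text \<open>Points within distance 1 of \<open>x\<close> are covered by the previous bound;
  elsewhere the kernel is at most 1. The bound depends on neither \<open>x\<close> nor
  \<open>c\<close>, which matters when it is integrated over \<open>x\<close>.\<close>

lemma riesz_potential_lborel_ball:
  fixes x :: complex
  assumes "0 < d" "d < 2" "0 \<le> R"
  shows "(\<integral>\<^sup>+y. ennreal (dist x y powr (-d)) * indicator (ball c R) y \<partial>lborel)
    \<le> ennreal (pi + pi * d / (2 - d) + pi * R\<^sup>2)"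
proof -
  have "(\<integral>\<^sup>+y. ennreal (dist x y powr (-d)) * indicator (ball c R) y \<partial>lborel)
      \<le> (\<integral>\<^sup>+y. ennreal (dist x y powr (-d)) * indicator (ball x 1) y + indicator (ball c R) y \<partial>lborel)"
  proof (intro nn_integral_mono)
    fix y
    show "ennreal (dist x y powr (-d)) * indicator (ball c R) y
      \<le> ennreal (dist x y powr (-d)) * indicator (ball x 1) y + indicator (ball c R) y"
    proof (cases "dist x y < 1")
      case False
      then have "dist x y powr (-d) \<le> 1"
        using powr_mono2'[of "-d" 1 "dist x y"] assms by simp
      then show ?thesis using False by (auto split: split_indicator)
    qed (auto split: split_indicator)
  qed
  also have "\<dots> = (\<integral>\<^sup>+y. ennreal (dist x y powr (-d)) * indicator (ball x 1) y \<partial>lborel) + ennreal (pi * R\<^sup>2)"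
    using assms by (subst nn_integral_add) (auto simp: emeasure_lborel_ball_complex)
  also have "\<dots> \<le> ennreal (pi + pi * d / (2 - d)) + ennreal (pi * R\<^sup>2)"
    using assms by (intro add_right_mono riesz_potential_lborel) auto
  also have "\<dots> = ennreal (pi + pi * d / (2 - d) + pi * R\<^sup>2)"
    using assms by (intro ennreal_plus[symmetric]) auto
  finally show ?thesis .
qed

text \<open>
  With \<open>p = |x - y|\<close>, \<open>q = |x - z|\<close> and \<open>d\<close> smaller than the growth exponent, the powers with
  exponent \<open>-d\<close> have bounded potentials and those with exponent \<open>d - 2\<close> are locally integrable in \<open>x\<close>,
  so that the Cauchy transform is locally square integrable.
\<close>

lemma inverse_prod_le_powr:
  fixes p q d :: real
  assumes "0 \<le> p" "0 \<le> q" "d \<le> 1"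
  shows "inverse p * inverse q \<le> p powr (d - 2) * q powr (-d) + p powr (-d) * q powr (d - 2)"
proof -
  have *: "inverse p * inverse q \<le> p powr (d - 2) * q powr (-d)" if "0 < p" "p \<le> q" for p q
  proof -
    have "0 < q" using that by linarith
    have "p powr (1 - d) \<le> q powr (1 - d)" using that assms by (intro powr_mono2) auto
    then have "1 \<le> p powr (d - 1) * q powr (1 - d)"
      using that by (subst (asm) mult_le_cancel_left_pos[symmetric, of "p powr (d - 1)"])
        (simp_all flip: powr_add)
    then have "inverse p * inverse q \<le> inverse p * inverse q * (p powr (d - 1) * q powr (1 - d))"
      using that \<open>0 < q\<close> mult_left_mono[of 1 _ "inverse p * inverse q"] by simp
    also have "\<dots> = (p powr (-1) * p powr (d - 1)) * (q powr (-1) * q powr (1 - d))"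
      using that \<open>0 < q\<close> by (simp add: powr_minus)
    also have "\<dots> = p powr (d - 2) * q powr (-d)"
      by (simp only: powr_add[symmetric]) simp
    finally show ?thesis .
  qed
  consider "p = 0 \<or> q = 0" | "0 < p" "p \<le> q" | "0 < q" "q \<le> p" using assms by linarith
  then show ?thesis
  proof cases
    case 2
    from *[OF this] show ?thesis by (simp add: add_increasing2)
  next
    case 3
    from *[OF this] show ?thesis by (simp add: mult.commute add_increasing)
  qed auto
qed

text \<open>The positive measures to which the estimate is applied: the two Jordan parts, moved to
  the complex plane, and their restrictions to discs.\<close>

locale growth_measure = finite_measure N for N :: "complex measure" +
  fixes C \<beta> :: real
  assumes sets_N [measurable_cong, simp]: "sets N = sets borel"
    and C_pos: "0 < C" and \<beta>_pos: "0 < \<beta>"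
    and growth: "\<And>x t. 0 < t \<Longrightarrow> emeasure N (cball x t) \<le> ennreal (C * t powr \<beta>)"
begin

lemma measurable_balls_N [measurable]: "ball c r \<in> sets N" "cball c r \<in> sets N"
  by simp_all

lemma space_N [simp]: "space N = UNIV"
  using sets_eq_imp_space_eq[OF sets_N] by simp

definition mass :: real where "mass = measure N UNIV"

lemma mass_nonneg [simp]: "0 \<le> mass" by (simp add: mass_def)

lemma emeasure_UNIV: "emeasure N UNIV = ennreal mass"
  by (simp add: mass_def emeasure_eq_measure)

text \<open>Finiteness at \<open>x\<close> means that the Bochner integral \<open>cauchy x\<close>
  is a true integral and not a default value. The point \<open>y = x\<close> contributes 0, as
  \<open>inverse 0 = 0\<close>.\<close>

definition abs_potential :: "complex \<Rightarrow> ennreal" where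
  "abs_potential x = (\<integral>\<^sup>+y. ennreal (norm (inverse (x - y))) \<partial>N)"

definition cauchy :: "complex \<Rightarrow> complex" where
  "cauchy x = (\<integral>y. inverse (x - y) \<partial>N)"

lemma measurable_abs_potential [measurable]: "abs_potential \<in> borel_measurable borel"
  unfolding abs_potential_def by measurable

lemma measurable_cauchy [measurable]: "cauchy \<in> borel_measurable borel"
  unfolding cauchy_def by measurable

lemma norm_cauchy_le: "ennreal (norm (cauchy x)) \<le> abs_potential x"
proof (cases "integrable N (\<lambda>y. inverse (x - y))")
  case True
  then show ?thesis unfolding cauchy_def abs_potential_def by (rule integral_norm_bound_ennreal)
qed (simp add: cauchy_def not_integrable_integral_eq)

text \<open>Lowering the growth exponent to at most 1 keeps the growth bound for radii up to 1, and
  half of it is an admissible \<open>d\<close> below 1. Points at distance at least 1 add no more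
  than the total mass.\<close>

lemma riesz_potential_finite:
  obtains d K where "0 < d" "d < 1"
    "\<And>x. (\<integral>\<^sup>+y. ennreal (dist x y powr (-d)) \<partial>N) \<le> ennreal K"
proof -
  define a where "a = min \<beta> 1"
  define d where "d = a / 2"
  have ad: "0 < a" "a \<le> \<beta>" "0 < d" "d < 1" "d < a" using \<beta>_pos by (auto simp: a_def d_def)
  define K where "K = C + C * d / (a - d)"
  have "0 \<le> K" using ad C_pos by (auto simp: K_def)
  have "(\<integral>\<^sup>+y. ennreal (dist x y powr (-d)) \<partial>N) \<le> ennreal (K + mass)" for x
  proof -
    have "(\<integral>\<^sup>+y. ennreal (dist x y powr (-d)) \<partial>N)
        \<le> (\<integral>\<^sup>+y. ennreal (dist x y powr (-d)) * indicator (ball x 1) y + 1 \<partial>N)"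
    proof (intro nn_integral_mono)
      fix y
      show "ennreal (dist x y powr (-d)) \<le> ennreal (dist x y powr (-d)) * indicator (ball x 1) y + 1"
      proof (cases "dist x y < 1")
        case False
        then have "dist x y powr (-d) \<le> 1"
          using powr_mono2'[of "-d" 1 "dist x y"] ad by simp
        then show ?thesis using False by auto
      qed auto
    qed
    also have "\<dots> = (\<integral>\<^sup>+y. ennreal (dist x y powr (-d)) * indicator (ball x 1) y \<partial>N) + ennreal mass"
      by (subst nn_integral_add) (auto simp: emeasure_UNIV)
    also have "(\<integral>\<^sup>+y. ennreal (dist x y powr (-d)) * indicator (ball x 1) y \<partial>N) \<le> ennreal K"
      unfolding K_def
    proof (rule riesz_potential_bound)
      fix t :: real assume t: "0 < t" "t \<le> 1"
      have "C * t powr \<beta> \<le> C * t powr a"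
        using t ad C_pos by (intro mult_left_mono powr_mono') auto
      then show "emeasure N (cball x t) \<le> ennreal (C * t powr a)"
        using growth[OF t(1), of x] by (meson ennreal_leI order_trans)
    qed (use ad C_pos in \<open>auto intro: sigma_finite_measure_axioms\<close>)
    also have "ennreal K + ennreal mass = ennreal (K + mass)"
      using \<open>0 \<le> K\<close> by simp
    finally show ?thesis by (simp add: add_right_mono)
  qed
  with ad that show ?thesis by blast
qed

text \<open>The square is a double integral over \<open>y\<close> and \<open>z\<close>, bounded by
  \<open>inverse_prod_le_powr\<close>. This gives \<open>2 * K * S x\<close>, because
  \<open>T\<close> is bounded by \<open>K\<close>; and \<open>S\<close> is integrable over discs by
  Fubini.\<close>

lemma abs_potential_L2_local:
  "(\<integral>\<^sup>+x. (abs_potential x)\<^sup>2 * indicator (ball c R) x \<partial>lborel) < \<infinity>"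
proof (cases "0 \<le> R")
  case False
  then show ?thesis by (simp add: ball_empty)
next
  case R: True
  obtain d K where d: "0 < d" "d < 1"
    and K: "\<And>x. (\<integral>\<^sup>+y. ennreal (dist x y powr (-d)) \<partial>N) \<le> ennreal K"
    using riesz_potential_finite by metis
  define S where "S x = (\<integral>\<^sup>+y. ennreal (dist x y powr (d - 2)) \<partial>N)" for x
  define T where "T x = (\<integral>\<^sup>+y. ennreal (dist x y powr (-d)) \<partial>N)" for x
  have [measurable]: "S \<in> borel_measurable borel" "T \<in> borel_measurable borel"
    unfolding S_def T_def by measurable
  interpret P: pair_sigma_finite N "lborel :: complex measure" ..
  have sq: "(abs_potential x)\<^sup>2 \<le> 2 * ennreal K * S x" for x
  proof -
    have "(abs_potential x)\<^sup>2 = (\<integral>\<^sup>+y. (\<integral>\<^sup>+z. ennreal (norm (inverse (x - y))) * ennreal (norm (inverse (x - z))) \<partial>N) \<partial>N)"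
      unfolding abs_potential_def power2_eq_square
      by (simp add: nn_integral_cmult nn_integral_multc)
    also have "\<dots> \<le> (\<integral>\<^sup>+y. (\<integral>\<^sup>+z. ennreal (dist x y powr (d - 2)) * ennreal (dist x z powr (-d))
        + ennreal (dist x y powr (-d)) * ennreal (dist x z powr (d - 2)) \<partial>N) \<partial>N)"
    proof (intro nn_integral_mono)
      fix y z
      show "ennreal (norm (inverse (x - y))) * ennreal (norm (inverse (x - z)))
        \<le> ennreal (dist x y powr (d - 2)) * ennreal (dist x z powr (-d))
        + ennreal (dist x y powr (-d)) * ennreal (dist x z powr (d - 2))"
        using inverse_prod_le_powr[of "dist x y" "dist x z" d] d
        by (simp add: norm_inverse dist_norm flip: ennreal_mult ennreal_plus)
    qed
    also have "\<dots> = S x * T x + T x * S x"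
      by (simp add: nn_integral_add nn_integral_cmult nn_integral_multc flip: S_def T_def)
    also have "\<dots> \<le> S x * ennreal K + ennreal K * S x"
      using K[of x] by (intro add_mono mult_left_mono mult_right_mono) (auto simp: T_def)
    also have "\<dots> = 2 * ennreal K * S x"
      by (simp only: mult.commute[of "S x"] mult_2[symmetric] mult.assoc)
    finally show ?thesis .
  qed
  have "(\<integral>\<^sup>+x. S x * indicator (ball c R) x \<partial>lborel)
      = (\<integral>\<^sup>+x. (\<integral>\<^sup>+y. ennreal (dist x y powr (d - 2)) * indicator (ball c R) x \<partial>N) \<partial>lborel)"
    unfolding S_def by (simp add: nn_integral_multc)
  also have "\<dots> = (\<integral>\<^sup>+y. (\<integral>\<^sup>+x. ennreal (dist x y powr (d - 2)) * indicator (ball c R) x \<partial>lborel) \<partial>N)"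
    by (rule P.Fubini') measurable
  \<comment> \<open>The exponent \<open>2 - d\<close> lies strictly between 1 and 2, and the bound
    is uniform in \<open>y\<close>.\<close>
  also have "\<dots> \<le> (\<integral>\<^sup>+y. ennreal (pi + pi * (2 - d) / (2 - (2 - d)) + pi * R\<^sup>2) \<partial>N)"
    using riesz_potential_lborel_ball[of "2 - d" R _ c] d R
    by (intro nn_integral_mono) (simp add: dist_commute)
  also have "\<dots> < \<infinity>"
    by (simp add: emeasure_UNIV ennreal_mult_less_top)
  finally have fin: "(\<integral>\<^sup>+x. S x * indicator (ball c R) x \<partial>lborel) < \<infinity>" .
  have "(\<integral>\<^sup>+x. (abs_potential x)\<^sup>2 * indicator (ball c R) x \<partial>lborel)
      \<le> (\<integral>\<^sup>+x. 2 * ennreal K * (S x * indicator (ball c R) x) \<partial>lborel)"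
    using sq by (intro nn_integral_mono) (auto split: split_indicator)
  also have "\<dots> = 2 * ennreal K * (\<integral>\<^sup>+x. S x * indicator (ball c R) x \<partial>lborel)"
    by (rule nn_integral_cmult) measurable
  also have "\<dots> < \<infinity>"
    using fin by (simp add: ennreal_mult_less_top)
  finally show ?thesis .
qed

lemma abs_potential_L1_local:
  "(\<integral>\<^sup>+x. abs_potential x * indicator (ball c R) x \<partial>lborel) < \<infinity>"
proof -
  have le: "a \<le> a\<^sup>2 + 1" for a :: ennreal
  proof (cases "a \<le> 1")
    case True
    then show ?thesis by (simp add: add_increasing)
  next
    case False
    then have "a * 1 \<le> a * a" by (intro mult_left_mono) auto
    then show ?thesis by (simp add: power2_eq_square add_increasing2)
  qed
  have "(\<integral>\<^sup>+x. abs_potential x * indicator (ball c R) x \<partial>lborel)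
      \<le> (\<integral>\<^sup>+x. (abs_potential x)\<^sup>2 * indicator (ball c R) x + indicator (ball c R) x \<partial>lborel)"
    using le by (intro nn_integral_mono) (auto split: split_indicator)
  also have "\<dots> = (\<integral>\<^sup>+x. (abs_potential x)\<^sup>2 * indicator (ball c R) x \<partial>lborel) + emeasure lborel (ball c R)"
    by (subst nn_integral_add) auto
  also have "\<dots> < \<infinity>"
    using abs_potential_L2_local[of c R] emeasure_lborel_ball_finite[of c R] by (simp add: less_top)
  finally show ?thesis .
qed

lemma AE_abs_potential_finite: "AE x in lborel. abs_potential x < \<infinity>"
proof -
  have "AE x in lborel. \<forall>n::nat. abs_potential x * indicator (ball 0 (real n)) x \<noteq> \<infinity>"
    unfolding AE_all_countable
  proof
    fix n :: nat
    show "AE x in lborel. abs_potential x * indicator (ball 0 (real n)) x \<noteq> \<infinity>"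
      using abs_potential_L1_local[of 0 "real n"] by (intro nn_integral_PInf_AE) auto
  qed
  then show ?thesis
  proof eventually_elim
    case (elim x)
    obtain n :: nat where "norm x < real n" using reals_Archimedean2 by blast
    with spec[OF elim, of n] show ?case by (simp add: less_top)
  qed
qed

lemma integrable_kernel: "abs_potential x < \<infinity> \<Longrightarrow> integrable N (\<lambda>y. inverse (x - y))"
  unfolding abs_potential_def by (intro integrableI_bounded) simp_all

lemma cauchy_L2_local:
  "(\<integral>\<^sup>+x. ennreal ((norm (cauchy x))\<^sup>2) * indicator (ball c R) x \<partial>lborel) < \<infinity>"
proof -
  have "(\<integral>\<^sup>+x. ennreal ((norm (cauchy x))\<^sup>2) * indicator (ball c R) x \<partial>lborel)
    \<le> (\<integral>\<^sup>+x. (abs_potential x)\<^sup>2 * indicator (ball c R) x \<partial>lborel)"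
    by (intro nn_integral_mono mult_right_mono)
      (auto simp: norm_cauchy_le simp flip: ennreal_power intro!: power_mono)
  with abs_potential_L2_local show ?thesis by (rule le_less_trans[rotated])
qed

end

section \<open>Averages of the Cauchy kernel\<close>

text \<open>This discards the borderline radius, at which neither of the two circle means of
  \<open>inverse\<close> applies.\<close>

lemma AE_norm_neq: "AE h in lborel. norm (h :: 'a::euclidean_space) \<noteq> t"
proof -
  have "sphere (0::'a) t \<in> null_sets lborel"
    using negligible_sphere[of "0::'a" t]
    by (auto simp: null_sets_completion_iff negligible_iff_null_sets negligible_convex_frontier)
  from AE_not_in[OF this] show ?thesis by simp
qed

text \<open>\<open>ennreal\<close> cuts off the negative part on the right, and a non-integrable
  \<open>f\<close> makes the left side 0.\<close>

lemma ennreal_integral_le: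
  fixes f :: "'a \<Rightarrow> real"
  shows "ennreal (integral\<^sup>L M f) \<le> (\<integral>\<^sup>+x. ennreal (f x) \<partial>M)"
proof (cases "integrable M f")
  case True
  then have "integral\<^sup>L M f \<le> (\<integral>x. max 0 (f x) \<partial>M)"
    by (intro integral_mono) auto
  then have "ennreal (integral\<^sup>L M f) \<le> ennreal (\<integral>x. max 0 (f x) \<partial>M)"
    by (rule ennreal_leI)
  also have "\<dots> = (\<integral>\<^sup>+x. ennreal (max 0 (f x)) \<partial>M)"
    using True by (intro nn_integral_eq_integral[symmetric]) auto
  also have "\<dots> = (\<integral>\<^sup>+x. ennreal (f x) \<partial>M)"
    by (intro nn_integral_cong) (auto simp: max_def ennreal_neg)
  finally show ?thesis .
qed (simp add: not_integrable_integral_eq)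

lemma inverse_ball_integrable:
  fixes v :: complex
  assumes "0 < r"
  shows "integrable lborel (\<lambda>h. indicator (ball 0 r) h *\<^sub>R inverse (v + h))"
proof (rule integrableI_bounded)
  have "(\<integral>\<^sup>+h. ennreal (norm (indicator (ball 0 r) h *\<^sub>R inverse (v + h))) \<partial>lborel)
      = (\<integral>\<^sup>+h. ennreal (dist (- v) h powr (- 1)) * indicator (ball 0 r) h \<partial>lborel)"
  proof (intro nn_integral_cong)
    fix h
    have "dist (- v) h = norm (v + h)"
      by (simp add: dist_norm) (metis norm_minus_cancel minus_diff_eq diff_minus_eq_add add.commute)
    then show "ennreal (norm (indicator (ball 0 r) h *\<^sub>R inverse (v + h)))
        = ennreal (dist (- v) h powr (- 1)) * indicator (ball 0 r) h"
      by (simp add: powr_minus norm_inverse split: split_indicator)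
  qed
  also have "\<dots> \<le> ennreal (pi + pi * 1 / (2 - 1) + pi * r\<^sup>2)"
    using assms by (intro riesz_potential_lborel_ball) auto
  also have "\<dots> < \<infinity>" by simp
  finally show "(\<integral>\<^sup>+h. ennreal (norm (indicator (ball 0 r) h *\<^sub>R inverse (v + h))) \<partial>lborel) < \<infinity>" .
qed simp

text \<open>Newton's theorem for a disc: after averaging over rotations of \<open>h\<close>, the
  points with \<open>norm h < norm v\<close> contribute \<open>inverse v\<close> each and those with
  \<open>norm h > norm v\<close> contribute nothing.\<close>

lemma integral_inverse_ball:
  fixes v :: complex
  assumes r: "0 < r"
  shows "(\<integral>h. indicator (ball 0 r) h *\<^sub>R inverse (v + h) \<partial>lborel)
    = of_real (pi * (min r (norm v))\<^sup>2) * inverse v"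
proof -
  have "(\<integral>h. indicator (ball 0 r) h *\<^sub>R inverse (v + h) \<partial>lborel)
      = (\<integral>h. (\<integral>z. indicator (ball 0 r) (z * h) *\<^sub>R inverse (v + z * h) \<partial>circle_measure) \<partial>lborel)"
    by (rule integral_rotation_average[OF inverse_ball_integrable[OF r]])
  also have "\<dots> = (\<integral>h. indicator (ball (0::complex) (min r (norm v))) h *\<^sub>R inverse v \<partial>lborel)"
  proof (rule integral_cong_AE)
    show "AE h in lborel. (\<integral>z. indicator (ball 0 r) (z * h) *\<^sub>R inverse (v + z * h) \<partial>circle_measure)
        = indicator (ball 0 (min r (norm v))) h *\<^sub>R inverse v"
      using AE_norm_neq[of "norm v"]
    proof eventually_elim
      case (elim h)
      have "(\<integral>z. indicator (ball 0 r) (z * h) *\<^sub>R inverse (v + z * h) \<partial>circle_measure)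
          = (\<integral>z. indicator (ball 0 r) h *\<^sub>R inverse (v + z * h) \<partial>circle_measure)"
        using AE_circle_measure
        by (intro integral_cong_AE) (auto simp: norm_mult split: split_indicator)
      also have "\<dots> = indicator (ball 0 r) h *\<^sub>R (\<integral>z. inverse (v + z * h) \<partial>circle_measure)"
        by simp
      also have "\<dots> = indicator (ball 0 (min r (norm v))) h *\<^sub>R inverse v"
        using elim circle_mean_inverse_inside[of h v] circle_mean_inverse_outside[of v h]
        by (cases "norm h < norm v") (auto split: split_indicator)
      finally show ?case .
    qed
  qed simp_all
  also have "\<dots> = of_real (measure lborel (ball (0::complex) (min r (norm v)))) * inverse v"
    by (simp add: scaleR_conv_of_real)
  also have "measure lborel (ball (0::complex) (min r (norm v))) = pi * (min r (norm v))\<^sup>2"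
    using r by (simp add: measure_lborel_ball_complex)
  finally show ?thesis .
qed

text \<open>For \<open>0 < r\<close> this is \<open>inverse v\<close> minus the mean of
  \<open>inverse (v + h)\<close> over \<open>h\<close> in \<open>ball 0 r\<close>; the two cancel
  for \<open>norm v \<ge> r\<close>.\<close>

definition local_kernel :: "real \<Rightarrow> complex \<Rightarrow> complex" where
  "local_kernel r v = (if norm v < r then of_real (1 - (norm v)\<^sup>2 / r\<^sup>2) * inverse v else 0)"

text \<open>For \<open>v \<noteq> 0\<close> this is the real number
  \<open>local_kernel r v * cnj (inverse v)\<close>.\<close>

definition radial_weight :: "real \<Rightarrow> complex \<Rightarrow> real" where
  "radial_weight r v = (if norm v < r then 1 / (norm v)\<^sup>2 - 1 / r\<^sup>2 else 0)"

lemma measurable_local_kernel [measurable]: "local_kernel r \<in> borel_measurable borel"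
  unfolding local_kernel_def by measurable

lemma measurable_radial_weight [measurable]: "radial_weight r \<in> borel_measurable borel"
  unfolding radial_weight_def by measurable

lemma local_kernel_eq:
  assumes "0 < r"
  shows "local_kernel r v = inverse v - of_real ((min r (norm v))\<^sup>2 / r\<^sup>2) * inverse v"
  using assms by (auto simp: local_kernel_def min_def algebra_simps)

lemma norm_local_kernel_le: "norm (local_kernel r v) \<le> norm (inverse v)"
proof (cases "norm v < r")
  case True
  then have "0 < r" using norm_ge_zero[of v] by linarith
  have "(norm v)\<^sup>2 \<le> r\<^sup>2" using True by (intro power_mono) auto
  then have "\<bar>1 - (norm v)\<^sup>2 / r\<^sup>2\<bar> \<le> 1" using \<open>0 < r\<close> by (auto simp: abs_le_iff)
  then have "\<bar>1 - (norm v)\<^sup>2 / r\<^sup>2\<bar> * norm (inverse v) \<le> 1 * norm (inverse v)"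
    by (intro mult_right_mono) auto
  then show ?thesis using True by (simp only: local_kernel_def norm_mult norm_of_real if_True mult_1_left)
qed (simp add: local_kernel_def)

text \<open>Averaging over rotations of \<open>v\<close> leaves a mean of
  \<open>inverse (p + z * a)\<close> with \<open>p = (norm v)^2\<close> and
  \<open>a = v * cnj w\<close>. It is \<open>inverse p\<close> for \<open>norm w < norm v\<close>
  and 0 for \<open>norm w > norm v\<close>, which produces \<open>radial_weight\<close>. If the left
  integrand is not integrable, the left side is 0.\<close>

lemma kernel_interaction_le:
  assumes r: "0 < r"
  shows "ennreal (Re (\<integral>v. local_kernel r v * cnj (inverse (v + w)) \<partial>lborel))
    \<le> (\<integral>\<^sup>+v. ennreal (radial_weight r v) * indicator {v. norm w < norm v} v \<partial>lborel)"
proof (cases "integrable lborel (\<lambda>v. local_kernel r v * cnj (inverse (v + w)))")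
  case True
  have "(\<integral>v. local_kernel r v * cnj (inverse (v + w)) \<partial>lborel)
      = (\<integral>v. (\<integral>z. local_kernel r (z * v) * cnj (inverse (z * v + w)) \<partial>circle_measure) \<partial>lborel)"
    by (rule integral_rotation_average[OF True])
  also have "\<dots> = (\<integral>v. complex_of_real (radial_weight r v * indicator {v. norm w < norm v} v) \<partial>lborel)"
  proof (rule integral_cong_AE)
    show "AE v in lborel. (\<integral>z. local_kernel r (z * v) * cnj (inverse (z * v + w)) \<partial>circle_measure)
        = complex_of_real (radial_weight r v * indicator {v. norm w < norm v} v)"
      using AE_norm_neq[of "norm w"] AE_norm_neq[of 0]
    proof eventually_elim
      case (elim v)
      have v: "0 < norm v" using elim by simp
      let ?s = "if norm v < r then complex_of_real (1 - (norm v)\<^sup>2 / r\<^sup>2) else 0"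
      let ?p = "complex_of_real ((norm v)\<^sup>2)"
      have "(\<integral>z. local_kernel r (z * v) * cnj (inverse (z * v + w)) \<partial>circle_measure)
          = (\<integral>z. ?s * inverse (?p + z * (v * cnj w)) \<partial>circle_measure)"
      proof (rule integral_cong_AE)
        show "AE z in circle_measure. local_kernel r (z * v) * cnj (inverse (z * v + w))
            = ?s * inverse (?p + z * (v * cnj w))"
          using AE_circle_measure
        proof eventually_elim
          case (elim z)
          \<comment> \<open>As \<open>norm z = 1\<close>, the product
            \<open>(z * v) * cnj (z * v + w)\<close> becomes affine in \<open>z\<close>.\<close>
          have "?p = (z * v) * cnj (z * v)"
            using elim by (simp only: complex_norm_square[symmetric] norm_mult) simp
          then have "?p + z * (v * cnj w) = (z * v) * cnj (z * v + w)"
            by (simp add: algebra_simps)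
          then have "inverse (z * v) * cnj (inverse (z * v + w)) = inverse (?p + z * (v * cnj w))"
            by simp
          moreover have "local_kernel r (z * v) = ?s * inverse (z * v)"
            using elim by (simp add: local_kernel_def norm_mult)
          ultimately show ?case by (simp only: mult.assoc)
        qed
      qed simp_all
      also have "\<dots> = ?s * (\<integral>z. inverse (?p + z * (v * cnj w)) \<partial>circle_measure)"
        by simp
      also have "\<dots> = complex_of_real (radial_weight r v * indicator {v. norm w < norm v} v)"
      proof (cases "norm w < norm v")
        case True
        then have "norm (v * cnj w) < norm ?p"
          using v by (simp add: norm_mult power2_eq_square)
        from circle_mean_inverse_inside[OF this]
        have "(\<integral>z. inverse (?p + z * (v * cnj w)) \<partial>circle_measure) = inverse ?p" .
        then show ?thesis using True v
          by (simp add: radial_weight_def field_simps)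
      next
        case False
        then have "norm ?p < norm (v * cnj w)"
          using v elim by (simp add: norm_mult power2_eq_square)
        from circle_mean_inverse_outside[OF this] show ?thesis using False by simp
      qed
      finally show ?case .
    qed
  qed simp_all
  also have "\<dots> = complex_of_real (\<integral>v. radial_weight r v * indicator {v. norm w < norm v} v \<partial>lborel)"
    by (rule integral_complex_of_real)
  finally have "ennreal (Re (\<integral>v. local_kernel r v * cnj (inverse (v + w)) \<partial>lborel))
      = ennreal (\<integral>v. radial_weight r v * indicator {v. norm w < norm v} v \<partial>lborel)"
    by simp
  also have "\<dots> \<le> (\<integral>\<^sup>+v. ennreal (radial_weight r v * indicator {v. norm w < norm v} v) \<partial>lborel)"
    by (rule ennreal_integral_le)
  also have "\<dots> = (\<integral>\<^sup>+v. ennreal (radial_weight r v) * indicator {v. norm w < norm v} v \<partial>lborel)"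
    by (intro nn_integral_cong) (auto split: split_indicator)
  finally show ?thesis .
qed (simp add: not_integrable_integral_eq)

text \<open>\<open>radial_weight r v\<close> is the integral of \<open>2 / t ^ 3\<close> over
  \<open>t\<close> from \<open>norm v\<close> to \<open>r\<close>. After the exchange,
  \<open>norm v powr b \<le> t powr b\<close> on a disc of area \<open>pi * t^2\<close> leaves
  \<open>2 * pi * C * t powr (b - 1)\<close>.\<close>

lemma nn_integral_radial_weight_powr:
  assumes r: "0 < r" and C: "0 < C" and b: "0 < b"
  shows "(\<integral>\<^sup>+v. ennreal (radial_weight r v) * ennreal (C * norm v powr b) \<partial>lborel)
    \<le> ennreal (2 * pi * C * r powr b / b)"
proof -
  let ?k = "\<lambda>(v::complex) t. if norm v \<le> t \<and> 0 < t \<and> t \<le> r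
    then ennreal (2 / t ^ 3) * ennreal (C * norm v powr b) else 0"
  have pw: "ennreal (radial_weight r v) * ennreal (C * norm v powr b) \<le> (\<integral>\<^sup>+t. ?k v t \<partial>lborel)" for v
  proof (cases "norm v < r \<and> v \<noteq> 0")
    case True
    define D where "D = norm v"
    have D: "0 < D" "D < r" using True by (auto simp: D_def)
    have "(\<integral>\<^sup>+t. ?k v t \<partial>lborel)
        = (\<integral>\<^sup>+t. (ennreal (2 / t ^ 3) * indicator {D..r} t) * ennreal (C * D powr b) \<partial>lborel)"
      using D by (intro nn_integral_cong) (auto simp: D_def[symmetric] split: split_indicator)
    also have "\<dots> = (\<integral>\<^sup>+t\<in>{D..r}. ennreal (2 / t ^ 3) \<partial>lborel) * ennreal (C * D powr b)"
      by (rule nn_integral_multc) simp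
    \<comment> \<open>The antiderivative is \<open>- (1 / t^2)\<close>.\<close>
    also have "(\<integral>\<^sup>+t\<in>{D..r}. ennreal (2 / t ^ 3) \<partial>lborel) = ennreal (- (1 / r\<^sup>2) - - (1 / D\<^sup>2))"
      using D
      by (intro nn_integral_FTC_Icc)
        (auto intro!: derivative_eq_intros simp: field_simps power2_eq_square power3_eq_cube)
    also have "\<dots> = ennreal (radial_weight r v)"
      using D by (simp add: radial_weight_def flip: D_def)
    finally show ?thesis by (simp add: D_def)
  next
    case False
    \<comment> \<open>At \<open>v = 0\<close> this relies on \<open>1 / 0 = 0\<close>.\<close>
    then have "radial_weight r v \<le> 0" by (auto simp: radial_weight_def)
    then show ?thesis by (simp add: ennreal_neg)
  qed
  have "(\<integral>\<^sup>+v. ennreal (radial_weight r v) * ennreal (C * norm v powr b) \<partial>lborel)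
      \<le> (\<integral>\<^sup>+v. (\<integral>\<^sup>+t. ?k v t \<partial>lborel) \<partial>lborel)"
    by (intro nn_integral_mono pw)
  also have "\<dots> = (\<integral>\<^sup>+t. (\<integral>\<^sup>+v. ?k v t \<partial>lborel) \<partial>lborel)"
    by (rule lborel_pair.Fubini'[symmetric]) measurable
  also have "\<dots> \<le> (\<integral>\<^sup>+t. ennreal (if t \<in> {0..r} then 2 * pi * C * t powr (b - 1) else 0) \<partial>lborel)"
  proof (intro nn_integral_mono)
    fix t :: real
    show "(\<integral>\<^sup>+v. ?k v t \<partial>lborel) \<le> ennreal (if t \<in> {0..r} then 2 * pi * C * t powr (b - 1) else 0)"
    proof (cases "0 < t \<and> t \<le> r")
      case True
      have "(\<integral>\<^sup>+v. ?k v t \<partial>lborel) \<le> (\<integral>\<^sup>+v. ennreal (2 / t ^ 3 * (C * t powr b)) * indicator (cball 0 t) (v::complex) \<partial>lborel)"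
        using True C b
        by (intro nn_integral_mono)
          (auto simp flip: ennreal_mult intro!: ennreal_leI divide_right_mono mult_left_mono powr_mono2 split: split_indicator)
      also have "\<dots> = ennreal (2 / t ^ 3 * (C * t powr b)) * ennreal (pi * t\<^sup>2)"
        using True by (subst nn_integral_cmult_indicator) (auto simp: emeasure_lborel_cball_complex)
      also have "\<dots> = ennreal (2 * pi * C * t powr (b - 1))"
        using True C by (simp flip: ennreal_mult)
          (simp add: powr_diff field_simps power2_eq_square power3_eq_cube)
      finally show ?thesis using True by simp
    qed auto
  qed
  also have "\<dots> = ennreal (2 * pi * C * (r powr (b - 1 + 1) / (b - 1 + 1)))"
  proof -
    have "((\<lambda>t. 2 * pi * C * t powr (b - 1)) has_integral 2 * pi * C * (r powr (b - 1 + 1) / (b - 1 + 1))) {0..r}"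
      using r b by (intro has_integral_mult_right has_integral_powr_from_0) auto
    then have "((\<lambda>t. if t \<in> {0..r} then 2 * pi * C * t powr (b - 1) else 0) has_integral
        2 * pi * C * (r powr (b - 1 + 1) / (b - 1 + 1))) UNIV"
      by (simp only: has_integral_restrict_UNIV)
    from nn_integral_has_integral_lborel[OF _ _ this] show ?thesis
      using C by simp
  qed
  finally show ?thesis by simp
qed

section \<open>The squared oscillation of the Cauchy transform\<close>

text \<open>Fatou's lemma in the form used for exhaustion by discs, where the bounds hold from some
  index on and converge.\<close>

lemma nn_integral_le_of_tendsto:
  assumes [measurable]: "\<And>n::nat. u n \<in> borel_measurable M"
    and lim: "AE x in M. (\<lambda>n. u n x) \<longlonglongrightarrow> v x"
    and le: "\<forall>\<^sub>F n in sequentially. (\<integral>\<^sup>+x. u n x \<partial>M) \<le> ennreal (b n)" and b: "b \<longlonglongrightarrow> B"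
  shows "(\<integral>\<^sup>+x. v x \<partial>M) \<le> ennreal B"
proof -
  have "(\<integral>\<^sup>+x. v x \<partial>M) = (\<integral>\<^sup>+x. liminf (\<lambda>n. u n x) \<partial>M)"
    using lim by (intro nn_integral_cong_AE) (auto elim!: eventually_mono simp: lim_imp_Liminf)
  also have "\<dots> \<le> liminf (\<lambda>n. \<integral>\<^sup>+x. u n x \<partial>M)"
    by (rule nn_integral_liminf) simp
  also have "\<dots> \<le> liminf (\<lambda>n. ennreal (b n))"
    using le by (rule Liminf_mono)
  also have "\<dots> = ennreal B"
    using b by (intro lim_imp_Liminf tendsto_ennrealI) auto
  finally show ?thesis .
qed

context growth_measure
begin

section \<open>Disc means of the Cauchy transform and of its square\<close>

lemma abs_potential_ball_translate:
  "(\<integral>\<^sup>+h. abs_potential (x + h) * indicator (ball 0 r) h \<partial>lborel)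
    = (\<integral>\<^sup>+h. abs_potential h * indicator (ball x r) h \<partial>lborel)"
proof -
  have "(\<integral>\<^sup>+h. abs_potential (x + h) * indicator (ball 0 r) h \<partial>lborel)
      = (\<integral>\<^sup>+h. abs_potential (x + h) * indicator (ball x r) (x + h) \<partial>lborel)"
    by (intro nn_integral_cong) (auto simp: dist_norm split: split_indicator)
  also have "\<dots> = (\<integral>\<^sup>+h. abs_potential h * indicator (ball x r) h \<partial>lborel)"
    by (rule nn_integral_lborel_translate[of "\<lambda>h. abs_potential h * indicator (ball x r) h"]) measurable
  finally show ?thesis .
qed

text \<open>Local integrability of \<open>abs_potential\<close> permits Fubini in \<open>h\<close>
  and \<open>y\<close>, and \<open>integral_inverse_ball\<close> evaluates the integral over
  \<open>h\<close>.\<close>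

lemma cauchy_ball_average:
  assumes r: "0 < r"
  shows "(\<integral>h. indicator (ball 0 r) h *\<^sub>R cauchy (x + h) \<partial>lborel)
    = (\<integral>y. of_real (pi * (min r (norm (x - y)))\<^sup>2) * inverse (x - y) \<partial>N)" (is ?eq)
    and "integrable lborel (\<lambda>h. indicator (ball 0 r) h *\<^sub>R cauchy (x + h))" (is ?int)
proof -
  interpret P: pair_sigma_finite "lborel :: complex measure" N ..
  let ?F = "\<lambda>h y. indicator (ball 0 r) h *\<^sub>R inverse (x + h - y)"
  have int: "integrable (lborel \<Otimes>\<^sub>M N) (\<lambda>(h, y). ?F h y)"
  proof (rule integrableI_bounded)
    have "(\<integral>\<^sup>+p. ennreal (norm (case p of (h, y) \<Rightarrow> ?F h y)) \<partial>(lborel \<Otimes>\<^sub>M N))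
        = (\<integral>\<^sup>+h. (\<integral>\<^sup>+y. ennreal (norm (?F h y)) \<partial>N) \<partial>lborel)"
      by (subst nn_integral_fst[symmetric]) simp_all
    also have "\<dots> = (\<integral>\<^sup>+h. abs_potential (x + h) * indicator (ball 0 r) h \<partial>lborel)"
      by (intro nn_integral_cong) (auto simp: abs_potential_def split: split_indicator)
    also have "\<dots> < \<infinity>"
      unfolding abs_potential_ball_translate by (rule abs_potential_L1_local)
    finally show "(\<integral>\<^sup>+p. ennreal (norm (case p of (h, y) \<Rightarrow> ?F h y)) \<partial>(lborel \<Otimes>\<^sub>M N)) < \<infinity>" .
  qed simp
  have F: "(\<integral>y. ?F h y \<partial>N) = indicator (ball 0 r) h *\<^sub>R cauchy (x + h)" for h
    by (simp add: cauchy_def)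
  show ?int
    using P.integrable_fst[OF int] by (simp only: F)
  have "(\<integral>h. indicator (ball 0 r) h *\<^sub>R cauchy (x + h) \<partial>lborel) = (\<integral>h. (\<integral>y. ?F h y \<partial>N) \<partial>lborel)"
    by (simp only: F)
  also have "\<dots> = (\<integral>y. (\<integral>h. ?F h y \<partial>lborel) \<partial>N)"
    by (rule P.Fubini_integral[OF int, symmetric])
  also have "\<dots> = (\<integral>y. of_real (pi * (min r (norm (x - y)))\<^sup>2) * inverse (x - y) \<partial>N)"
  proof (rule Bochner_Integration.integral_cong[OF refl])
    fix y
    have "x + h - y = (x - y) + h" for h by simp
    then show "(\<integral>h. ?F h y \<partial>lborel) = of_real (pi * (min r (norm (x - y)))\<^sup>2) * inverse (x - y)"
      using integral_inverse_ball[OF r, of "x - y"] by (simp only:)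
  qed
  finally show ?eq .
qed

text \<open>For \<open>0 < r\<close>, wherever \<open>abs_potential x\<close> is finite, this is
  \<open>cauchy x\<close> minus the mean of \<open>cauchy\<close> over
  \<open>ball x r\<close>.\<close>

definition local_potential :: "real \<Rightarrow> complex \<Rightarrow> complex" where
  "local_potential r x = (\<integral>y. local_kernel r (x - y) \<partial>N)"

lemma measurable_local_potential [measurable]: "local_potential r \<in> borel_measurable borel"
  unfolding local_potential_def by measurable

lemma integrable_local_kernel:
  assumes "abs_potential x < \<infinity>"
  shows "integrable N (\<lambda>y. local_kernel r (x - y))"
  by (rule Bochner_Integration.integrable_bound[OF integrable_kernel[OF assms]])
    (simp_all add: norm_local_kernel_le)

lemma cauchy_ball_average_eq:
  assumes r: "0 < r" and x: "abs_potential x < \<infinity>"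
  shows "(\<integral>h. indicator (ball 0 r) h *\<^sub>R cauchy (x + h) \<partial>lborel)
    = of_real (pi * r\<^sup>2) * (cauchy x - local_potential r x)"
proof -
  have "of_real (pi * (min r (norm (x - y)))\<^sup>2) * inverse (x - y)
      = of_real (pi * r\<^sup>2) * (inverse (x - y) - local_kernel r (x - y))" for y
  proof -
    let ?m = "(min r (norm (x - y)))\<^sup>2"
    have "pi * ?m = pi * r\<^sup>2 * (?m / r\<^sup>2)" using r by simp
    then have "of_real (pi * ?m) * inverse (x - y)
        = of_real (pi * r\<^sup>2) * (of_real (?m / r\<^sup>2) * inverse (x - y))"
      by (simp only: of_real_mult mult.assoc)
    also have "of_real (?m / r\<^sup>2) * inverse (x - y) = inverse (x - y) - local_kernel r (x - y)"
      by (simp only: local_kernel_eq[OF r]) simp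
    finally show ?thesis .
  qed
  then have "(\<integral>h. indicator (ball 0 r) h *\<^sub>R cauchy (x + h) \<partial>lborel)
      = of_real (pi * r\<^sup>2) * (\<integral>y. inverse (x - y) - local_kernel r (x - y) \<partial>N)"
    unfolding cauchy_ball_average(1)[OF r] by (simp only: integral_mult_right_zero)
  also have "(\<integral>y. inverse (x - y) - local_kernel r (x - y) \<partial>N) = cauchy x - local_potential r x"
    unfolding cauchy_def local_potential_def
    by (rule Bochner_Integration.integral_diff[OF integrable_kernel[OF x] integrable_local_kernel[OF x]])
  finally show ?thesis .
qed

lemma cauchy_sq_translate:
  "(\<integral>\<^sup>+h. ennreal ((norm (cauchy (x + h)))\<^sup>2) * indicator (ball 0 r) h \<partial>lborel)
    = (\<integral>\<^sup>+h. ennreal ((norm (cauchy h))\<^sup>2) * indicator (ball x r) h \<partial>lborel)"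
proof -
  have "(\<integral>\<^sup>+h. ennreal ((norm (cauchy (x + h)))\<^sup>2) * indicator (ball 0 r) h \<partial>lborel)
      = (\<integral>\<^sup>+h. ennreal ((norm (cauchy (x + h)))\<^sup>2) * indicator (ball x r) (x + h) \<partial>lborel)"
    by (intro nn_integral_cong) (auto simp: dist_norm split: split_indicator)
  also have "\<dots> = (\<integral>\<^sup>+h. ennreal ((norm (cauchy h))\<^sup>2) * indicator (ball x r) h \<partial>lborel)"
    by (rule nn_integral_lborel_translate[of "\<lambda>h. ennreal ((norm (cauchy h))\<^sup>2) * indicator (ball x r) h"])
      measurable
  finally show ?thesis .
qed

lemma cauchy_sq_integrable:
  "integrable lborel (\<lambda>h. indicator (ball 0 r) h * (norm (cauchy (x + h)))\<^sup>2)"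
proof (rule integrableI_bounded)
  have "(\<integral>\<^sup>+h. ennreal (norm (indicator (ball 0 r) h * (norm (cauchy (x + h)))\<^sup>2)) \<partial>lborel)
      = (\<integral>\<^sup>+h. ennreal ((norm (cauchy (x + h)))\<^sup>2) * indicator (ball 0 r) h \<partial>lborel)"
    by (intro nn_integral_cong) (auto split: split_indicator)
  also have "\<dots> < \<infinity>" unfolding cauchy_sq_translate by (rule cauchy_L2_local)
  finally show "(\<integral>\<^sup>+h. ennreal (norm (indicator (ball 0 r) h * (norm (cauchy (x + h)))\<^sup>2)) \<partial>lborel) < \<infinity>" .
qed simp

text \<open>Not normalised, like \<open>sq_oscillation\<close> below: the area
  \<open>pi * r^2\<close> is divided out only at the very end.\<close>

definition sq_average :: "real \<Rightarrow> complex \<Rightarrow> real" where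
  "sq_average r x = (\<integral>h. indicator (ball 0 r) h * (norm (cauchy (x + h)))\<^sup>2 \<partial>lborel)"

lemma measurable_sq_average [measurable]: "sq_average r \<in> borel_measurable borel"
  unfolding sq_average_def by measurable

lemma ennreal_sq_average:
  "ennreal (sq_average r x) = (\<integral>\<^sup>+h. ennreal ((norm (cauchy (x + h)))\<^sup>2) * indicator (ball 0 r) h \<partial>lborel)"
  unfolding sq_average_def
  by (subst nn_integral_eq_integral[OF cauchy_sq_integrable, symmetric])
    (auto intro!: nn_integral_cong split: split_indicator)

lemma sq_average_nonneg: "0 \<le> sq_average r x"
  unfolding sq_average_def by (intro Bochner_Integration.integral_nonneg) simp

definition sq_oscillation :: "real \<Rightarrow> complex \<Rightarrow> ennreal" where
  "sq_oscillation r x = (\<integral>\<^sup>+h. ennreal ((norm (cauchy (x + h) - cauchy x))\<^sup>2) * indicator (ball 0 r) h \<partial>lborel)"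

lemma measurable_sq_oscillation [measurable]: "sq_oscillation r \<in> borel_measurable borel"
  unfolding sq_oscillation_def by measurable

text \<open>Expanding the square, the cross term contains the disc mean of \<open>cauchy\<close>,
  which is \<open>cauchy x - local_potential r x\<close>. The second claim ensures that
  \<open>ennreal\<close> truncates nothing in the first.\<close>

lemma sq_oscillation_eq:
  assumes r: "0 < r" and x: "abs_potential x < \<infinity>"
  shows "sq_oscillation r x = ennreal (sq_average r x - pi * r\<^sup>2 * (norm (cauchy x))\<^sup>2
      + 2 * (pi * r\<^sup>2) * Re (local_potential r x * cnj (cauchy x)))"
    and "0 \<le> sq_average r x - pi * r\<^sup>2 * (norm (cauchy x))\<^sup>2
      + 2 * (pi * r\<^sup>2) * Re (local_potential r x * cnj (cauchy x))"
proof -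
  let ?i = "indicator (ball (0::complex) r) :: complex \<Rightarrow> real"
  let ?f = "cauchy x"
  have i3: "integrable lborel (\<lambda>h. ?i h * (norm ?f)\<^sup>2)"
    by (intro integrable_mult_left integrable_real_indicator) (use r in \<open>simp_all add: emeasure_lborel_ball_complex\<close>)
  have i2: "integrable lborel (\<lambda>h. Re ((?i h *\<^sub>R cauchy (x + h)) * cnj ?f))"
    by (intro integrable_Re integrable_mult_left cauchy_ball_average r)
  have exp: "?i h * (norm (cauchy (x + h) - ?f))\<^sup>2
      = ?i h * (norm (cauchy (x + h)))\<^sup>2 - 2 * Re ((?i h *\<^sub>R cauchy (x + h)) * cnj ?f) + ?i h * (norm ?f)\<^sup>2" for h
    unfolding cmod_power2 by (simp add: power2_eq_square algebra_simps)
  have int: "integrable lborel (\<lambda>h. ?i h * (norm (cauchy (x + h) - ?f))\<^sup>2)"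
    unfolding exp using i2 i3 cauchy_sq_integrable by (intro Bochner_Integration.integrable_add Bochner_Integration.integrable_diff integrable_mult_right)
  have osc: "sq_oscillation r x = (\<integral>\<^sup>+h. ennreal (?i h * (norm (cauchy (x + h) - ?f))\<^sup>2) \<partial>lborel)"
    unfolding sq_oscillation_def by (intro nn_integral_cong) (auto split: split_indicator)
  have nn: "0 \<le> (\<integral>h. ?i h * (norm (cauchy (x + h) - ?f))\<^sup>2 \<partial>lborel)"
    by (intro Bochner_Integration.integral_nonneg) simp
  have "(\<integral>h. ?i h * (norm (cauchy (x + h) - ?f))\<^sup>2 \<partial>lborel)
      = sq_average r x - 2 * (\<integral>h. Re ((?i h *\<^sub>R cauchy (x + h)) * cnj ?f) \<partial>lborel)
        + (\<integral>h. ?i h * (norm ?f)\<^sup>2 \<partial>lborel)"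
    unfolding exp sq_average_def using i2 i3 cauchy_sq_integrable by simp
  also have "(\<integral>h. Re ((?i h *\<^sub>R cauchy (x + h)) * cnj ?f) \<partial>lborel)
      = Re ((\<integral>h. ?i h *\<^sub>R cauchy (x + h) \<partial>lborel) * cnj ?f)"
    using integral_bounded_linear[OF bounded_linear_Re integrable_mult_left[of "cnj ?f", OF cauchy_ball_average(2)[OF r, of x]]]
    by (simp only: integral_mult_left_zero)
  also have "(\<integral>h. ?i h *\<^sub>R cauchy (x + h) \<partial>lborel) = of_real (pi * r\<^sup>2) * (?f - local_potential r x)"
    by (rule cauchy_ball_average_eq[OF r x])
  also have "(\<integral>h. ?i h * (norm ?f)\<^sup>2 \<partial>lborel) = pi * r\<^sup>2 * (norm ?f)\<^sup>2"
    using r by (simp add: measure_lborel_ball_complex)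
  also have "sq_average r x - 2 * Re (of_real (pi * r\<^sup>2) * (?f - local_potential r x) * cnj ?f) + pi * r\<^sup>2 * (norm ?f)\<^sup>2
      = sq_average r x - pi * r\<^sup>2 * (norm ?f)\<^sup>2 + 2 * (pi * r\<^sup>2) * Re (local_potential r x * cnj ?f)"
    unfolding cmod_power2 by (simp add: power2_eq_square algebra_simps)
  finally have eq: "(\<integral>h. ?i h * (norm (cauchy (x + h) - ?f))\<^sup>2 \<partial>lborel)
      = sq_average r x - pi * r\<^sup>2 * (norm ?f)\<^sup>2 + 2 * (pi * r\<^sup>2) * Re (local_potential r x * cnj ?f)" .
  show "sq_oscillation r x = ennreal (sq_average r x - pi * r\<^sup>2 * (norm ?f)\<^sup>2
      + 2 * (pi * r\<^sup>2) * Re (local_potential r x * cnj ?f))"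
    unfolding osc eq[symmetric] by (intro nn_integral_eq_integral int) simp
  show "0 \<le> sq_average r x - pi * r\<^sup>2 * (norm ?f)\<^sup>2 + 2 * (pi * r\<^sup>2) * Re (local_potential r x * cnj ?f)"
    using nn unfolding eq .
qed

text \<open>By Fubini the integral over \<open>x\<close> comes first; a shift by \<open>h\<close>
  with \<open>norm h < r\<close> moves \<open>ball 0 R\<close> into
  \<open>ball 0 (R + r)\<close>.\<close>

lemma sq_average_ball:
  assumes r: "0 < r"
  shows "integrable lborel (\<lambda>x. indicator (ball 0 R) x * sq_average r x)"
    and "(\<integral>x. indicator (ball 0 R) x * sq_average r x \<partial>lborel)
      \<le> pi * r\<^sup>2 * (\<integral>x. indicator (ball 0 (R + r)) x * (norm (cauchy x))\<^sup>2 \<partial>lborel)"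
proof -
  let ?P = "\<lambda>x. ennreal ((norm (cauchy x))\<^sup>2)"
  let ?I = "\<integral>x. indicator (ball 0 (R + r)) x * (norm (cauchy x))\<^sup>2 \<partial>lborel"
  have I0: "0 \<le> ?I" by (intro Bochner_Integration.integral_nonneg) simp
  have I: "(\<integral>\<^sup>+x. ?P x * indicator (ball 0 (R + r)) x \<partial>lborel) = ennreal ?I"
    using cauchy_sq_integrable[of "R + r" 0]
    by (subst nn_integral_eq_integral[symmetric]) (auto intro!: nn_integral_cong split: split_indicator)
  have "(\<integral>\<^sup>+x. ennreal (indicator (ball 0 R) x * sq_average r x) \<partial>lborel)
      = (\<integral>\<^sup>+x. (\<integral>\<^sup>+h. ?P (x + h) * indicator (ball 0 r) h * indicator (ball 0 R) x \<partial>lborel) \<partial>lborel)"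
  proof (intro nn_integral_cong)
    fix x :: complex
    show "ennreal (indicator (ball 0 R) x * sq_average r x)
        = (\<integral>\<^sup>+h. ?P (x + h) * indicator (ball 0 r) h * indicator (ball 0 R) x \<partial>lborel)"
      by (cases "x \<in> ball 0 R") (simp_all add: ennreal_sq_average)
  qed
  also have "\<dots> = (\<integral>\<^sup>+h. (\<integral>\<^sup>+x. ?P (x + h) * indicator (ball 0 r) h * indicator (ball 0 R) x \<partial>lborel) \<partial>lborel)"
    by (rule lborel_pair.Fubini') measurable
  also have "\<dots> \<le> (\<integral>\<^sup>+h. ennreal ?I * indicator (ball (0::complex) r) h \<partial>lborel)"
  proof (intro nn_integral_mono)
    fix h
    show "(\<integral>\<^sup>+x. ?P (x + h) * indicator (ball 0 r) h * indicator (ball 0 R) x \<partial>lborel)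
      \<le> ennreal ?I * indicator (ball 0 r) h"
    proof (cases "h \<in> ball 0 r")
      case True
      have "(\<integral>\<^sup>+x. ?P (x + h) * indicator (ball 0 r) h * indicator (ball 0 R) x \<partial>lborel)
          \<le> (\<integral>\<^sup>+x. ?P (h + x) * indicator (ball 0 (R + r)) (h + x) \<partial>lborel)"
      proof (intro nn_integral_mono)
        fix x
        have "norm (h + x) < R + r" if "norm x < R"
          using True that norm_triangle_ineq[of h x] by simp
        then show "?P (x + h) * indicator (ball 0 r) h * indicator (ball 0 R) x
            \<le> ?P (h + x) * indicator (ball 0 (R + r)) (h + x)"
          by (auto simp: add.commute split: split_indicator)
      qed
      also have "\<dots> = ennreal ?I"
        unfolding I[symmetric]
        by (rule nn_integral_lborel_translate[of "\<lambda>x. ?P x * indicator (ball 0 (R + r)) x"]) measurable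
      finally show ?thesis using True by simp
    qed simp
  qed
  also have "\<dots> = ennreal (pi * r\<^sup>2 * ?I)"
    using r I0 by (subst nn_integral_cmult_indicator)
      (simp_all add: emeasure_lborel_ball_complex mult.commute flip: ennreal_mult)
  finally have le: "(\<integral>\<^sup>+x. ennreal (indicator (ball 0 R) x * sq_average r x) \<partial>lborel) \<le> ennreal (pi * r\<^sup>2 * ?I)" .
  show int: "integrable lborel (\<lambda>x. indicator (ball 0 R) x * sq_average r x)"
    using le by (intro integrableI_bounded) (auto simp: sq_average_nonneg abs_mult intro: le_less_trans)
  have "ennreal (\<integral>x. indicator (ball 0 R) x * sq_average r x \<partial>lborel) \<le> ennreal (pi * r\<^sup>2 * ?I)"
    using le by (subst nn_integral_eq_integral[OF int, symmetric]) (auto simp: sq_average_nonneg)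
  then show "(\<integral>x. indicator (ball 0 R) x * sq_average r x \<partial>lborel) \<le> pi * r\<^sup>2 * ?I"
    using r I0 by (simp add: ennreal_le_iff)
qed

end

section \<open>The interaction integral over pairs of points\<close>

context growth_measure
begin

text \<open>The integrand of \<open>local_potential r x * cnj (cauchy x)\<close>, written as one
  integral over pairs so that Fubini can be applied against \<open>x\<close>.\<close>

definition interaction :: "real \<Rightarrow> complex \<Rightarrow> complex \<times> complex \<Rightarrow> complex" where
  "interaction r x p = local_kernel r (x - fst p) * cnj (inverse (x - snd p))"

lemma measurable_interaction [measurable]:
  "(\<lambda>(x, p). interaction r x p) \<in> borel_measurable (lborel \<Otimes>\<^sub>M (N \<Otimes>\<^sub>M N))"
  "interaction r x \<in> borel_measurable (N \<Otimes>\<^sub>M N)"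
  "(\<lambda>x. interaction r x p) \<in> borel_measurable lborel"
  unfolding interaction_def by measurable

lemma norm_interaction_integral_le:
  "(\<integral>\<^sup>+p. ennreal (norm (interaction r x p)) \<partial>(N \<Otimes>\<^sub>M N))
    \<le> (\<integral>\<^sup>+y. ennreal (norm (local_kernel r (x - y))) \<partial>N) * abs_potential x"
proof -
  have "(\<integral>\<^sup>+p. ennreal (norm (interaction r x p)) \<partial>(N \<Otimes>\<^sub>M N))
      = (\<integral>\<^sup>+y. (\<integral>\<^sup>+z. ennreal (norm (local_kernel r (x - y))) * ennreal (norm (inverse (x - z))) \<partial>N) \<partial>N)"
    by (subst nn_integral_fst[symmetric])
      (simp_all add: interaction_def norm_mult ennreal_mult del: complex_cnj_inverse complex_cnj_diff)
  also have "\<dots> = (\<integral>\<^sup>+y. ennreal (norm (local_kernel r (x - y))) \<partial>N) * abs_potential x"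
    by (simp add: nn_integral_cmult nn_integral_multc flip: abs_potential_def)
  finally show ?thesis by simp
qed

lemma integral_interaction:
  assumes x: "abs_potential x < \<infinity>"
  shows "(\<integral>p. interaction r x p \<partial>(N \<Otimes>\<^sub>M N)) = local_potential r x * cnj (cauchy x)"
proof -
  interpret P: pair_sigma_finite N N ..
  have "(\<integral>\<^sup>+y. ennreal (norm (local_kernel r (x - y))) \<partial>N) \<le> abs_potential x"
    unfolding abs_potential_def by (intro nn_integral_mono ennreal_leI norm_local_kernel_le)
  then have "(\<integral>\<^sup>+y. ennreal (norm (local_kernel r (x - y))) \<partial>N) * abs_potential x < \<infinity>"
    using x by (auto simp: ennreal_mult_less_top intro: le_less_trans)
  then have "integrable (N \<Otimes>\<^sub>M N) (interaction r x)"
    using norm_interaction_integral_le[of r x] by (intro integrableI_bounded) (auto intro: le_less_trans)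
  then have "(\<integral>p. interaction r x p \<partial>(N \<Otimes>\<^sub>M N)) = (\<integral>y. (\<integral>z. interaction r x (y, z) \<partial>N) \<partial>N)"
    by (rule P.integral_fst'[symmetric])
  also have "\<dots> = (\<integral>y. (\<integral>z. local_kernel r (x - y) * cnj (inverse (x - z)) \<partial>N) \<partial>N)"
    by (simp only: interaction_def fst_conv snd_conv)
  also have "\<dots> = (\<integral>y. local_kernel r (x - y) * cnj (cauchy x) \<partial>N)"
    unfolding cauchy_def by (simp only: integral_mult_right_zero Bochner_Integration.integral_cnj)
  also have "\<dots> = local_potential r x * cnj (cauchy x)"
    unfolding local_potential_def by (simp only: integral_mult_left_zero)
  finally show ?thesis .
qed

text \<open>For fixed \<open>v\<close> and \<open>y\<close>, the points \<open>z\<close> with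
  \<open>norm (y - z) < norm v\<close> lie in a disc of radius \<open>norm v\<close>, so the pairs
  have mass at most \<open>C * norm v powr \<beta> * mass\<close>. What remains is the weighted
  integral over \<open>v\<close>.\<close>

lemma interaction_energy_le:
  assumes r: "0 < r"
  shows "(\<integral>\<^sup>+p. (\<integral>\<^sup>+v. ennreal (radial_weight r v) * indicator {v. norm (fst p - snd p) < norm v} v \<partial>lborel) \<partial>(N \<Otimes>\<^sub>M N))
    \<le> ennreal (mass * (2 * pi * C * r powr \<beta> / \<beta>))"
proof -
  interpret NN: pair_sigma_finite N N ..
  interpret P: pair_sigma_finite "N \<Otimes>\<^sub>M N" "lborel :: complex measure" ..
  have meas: "{p \<in> space (N \<Otimes>\<^sub>M N). norm (fst p - snd p) < norm (v::complex)} \<in> sets (N \<Otimes>\<^sub>M N)" for v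
    by measurable
  have inner: "(\<integral>\<^sup>+p. indicator {v. norm (fst p - snd p) < norm v} v \<partial>(N \<Otimes>\<^sub>M N))
      \<le> ennreal (C * norm v powr \<beta>) * ennreal mass" for v
  proof -
    have "(\<integral>\<^sup>+p. indicator {v. norm (fst p - snd p) < norm v} v \<partial>(N \<Otimes>\<^sub>M N))
        = (\<integral>\<^sup>+y. (\<integral>\<^sup>+z. indicator {v. norm (y - z) < norm v} v \<partial>N) \<partial>N)"
      by (subst nn_integral_fst[symmetric]) simp_all
    also have "\<dots> \<le> (\<integral>\<^sup>+y. ennreal (C * norm v powr \<beta>) \<partial>N)"
    proof (intro nn_integral_mono)
      fix y
      show "(\<integral>\<^sup>+z. indicator {v. norm (y - z) < norm v} v \<partial>N) \<le> ennreal (C * norm v powr \<beta>)"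
      \<comment> \<open>The growth bound speaks of positive radii only; for \<open>v = 0\<close> the
        set is empty.\<close>
      proof (cases "v = 0")
        case False
        have "(\<integral>\<^sup>+z. indicator {v. norm (y - z) < norm v} v \<partial>N) \<le> (\<integral>\<^sup>+z. indicator (cball y (norm v)) z \<partial>N)"
          by (intro nn_integral_mono) (auto simp: dist_norm split: split_indicator)
        also have "\<dots> \<le> ennreal (C * norm v powr \<beta>)"
          using growth[of "norm v" y] False by simp
        finally show ?thesis .
      qed simp
    qed
    also have "\<dots> = ennreal (C * norm v powr \<beta>) * ennreal mass"
      by (simp add: emeasure_UNIV)
    finally show ?thesis .
  qed
  have "(\<integral>\<^sup>+p. (\<integral>\<^sup>+v. ennreal (radial_weight r v) * indicator {v. norm (fst p - snd p) < norm v} v \<partial>lborel) \<partial>(N \<Otimes>\<^sub>M N))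
      = (\<integral>\<^sup>+v. (\<integral>\<^sup>+p. ennreal (radial_weight r v) * indicator {v. norm (fst p - snd p) < norm v} v \<partial>(N \<Otimes>\<^sub>M N)) \<partial>lborel)"
    by (rule P.Fubini'[symmetric]) measurable
  also have "\<dots> = (\<integral>\<^sup>+v. ennreal (radial_weight r v) * (\<integral>\<^sup>+p. indicator {v. norm (fst p - snd p) < norm v} v \<partial>(N \<Otimes>\<^sub>M N)) \<partial>lborel)"
    by (intro nn_integral_cong nn_integral_cmult) measurable
  also have "\<dots> \<le> (\<integral>\<^sup>+v. ennreal (radial_weight r v) * (ennreal (C * norm (v::complex) powr \<beta>) * ennreal mass) \<partial>lborel)"
    by (intro nn_integral_mono mult_left_mono inner) simp
  also have "\<dots> = (\<integral>\<^sup>+v. ennreal (radial_weight r v) * ennreal (C * norm (v::complex) powr \<beta>) \<partial>lborel) * ennreal mass"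
    by (simp add: nn_integral_multc flip: mult.assoc)
  also have "\<dots> \<le> ennreal (2 * pi * C * r powr \<beta> / \<beta>) * ennreal mass"
    by (intro mult_right_mono nn_integral_radial_weight_powr r C_pos \<beta>_pos) simp
  also have "\<dots> = ennreal (mass * (2 * pi * C * r powr \<beta> / \<beta>))"
    using C_pos \<beta>_pos by (simp add: mult.commute flip: ennreal_mult)
  finally show ?thesis .
qed

text \<open>The bounded support confines \<open>local_potential\<close> to
  \<open>ball 0 (R0 + r)\<close>, where \<open>abs_potential\<close> is square integrable; this
  justifies Fubini. The substitution \<open>x = fst p + v\<close> then turns the integral over
  \<open>x\<close> into the one in \<open>kernel_interaction_le\<close> with
  \<open>w = fst p - snd p\<close>.\<close>

lemma local_potential_cauchy_integral:
  assumes r: "0 < r" and supp: "AE y in N. norm y < R0"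
  shows "integrable lborel (\<lambda>x. local_potential r x * cnj (cauchy x))"
    and "Re (\<integral>x. local_potential r x * cnj (cauchy x) \<partial>lborel) \<le> mass * (2 * pi * C * r powr \<beta> / \<beta>)"
proof -
  interpret NN: pair_sigma_finite N N ..
  interpret P: pair_sigma_finite "lborel :: complex measure" "N \<Otimes>\<^sub>M N" ..
  have int: "integrable (lborel \<Otimes>\<^sub>M (N \<Otimes>\<^sub>M N)) (\<lambda>(x, p). interaction r x p)"
  proof (rule integrableI_bounded)
    have "(\<integral>\<^sup>+q. ennreal (norm (case q of (x, p) \<Rightarrow> interaction r x p)) \<partial>(lborel \<Otimes>\<^sub>M (N \<Otimes>\<^sub>M N)))
        = (\<integral>\<^sup>+x. (\<integral>\<^sup>+p. ennreal (norm (interaction r x p)) \<partial>(N \<Otimes>\<^sub>M N)) \<partial>lborel)"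
      by (subst NN.nn_integral_fst[symmetric]) simp_all
    also have "\<dots> \<le> (\<integral>\<^sup>+x. (abs_potential x)\<^sup>2 * indicator (ball 0 (R0 + r)) x \<partial>lborel)"
    proof (intro nn_integral_mono)
      fix x
      have "(\<integral>\<^sup>+y. ennreal (norm (local_kernel r (x - y))) \<partial>N) \<le> abs_potential x * indicator (ball 0 (R0 + r)) x"
      proof (cases "norm x < R0 + r")
        case True
        then show ?thesis
          unfolding abs_potential_def by (auto intro!: nn_integral_mono norm_local_kernel_le)
      next
        case False
        have "(\<integral>\<^sup>+y. ennreal (norm (local_kernel r (x - y))) \<partial>N) = (\<integral>\<^sup>+y. 0 \<partial>N)"
          using supp
        proof (intro nn_integral_cong_AE, eventually_elim)
          case (elim y)
          have "\<not> norm (x - y) < r" using False elim norm_triangle_ineq2[of x y] by linarith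
          then show ?case by (simp add: local_kernel_def)
        qed
        then show ?thesis by simp
      qed
      then have "(\<integral>\<^sup>+y. ennreal (norm (local_kernel r (x - y))) \<partial>N) * abs_potential x
          \<le> (abs_potential x * indicator (ball 0 (R0 + r)) x) * abs_potential x"
        by (rule mult_right_mono) simp
      with norm_interaction_integral_le[of r x]
      show "(\<integral>\<^sup>+p. ennreal (norm (interaction r x p)) \<partial>(N \<Otimes>\<^sub>M N))
          \<le> (abs_potential x)\<^sup>2 * indicator (ball 0 (R0 + r)) x"
        by (simp add: power2_eq_square mult_ac)
    qed
    also have "\<dots> < \<infinity>" by (rule abs_potential_L2_local)
    finally show "(\<integral>\<^sup>+q. ennreal (norm (case q of (x, p) \<Rightarrow> interaction r x p)) \<partial>(lborel \<Otimes>\<^sub>M (N \<Otimes>\<^sub>M N))) < \<infinity>" .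
  qed simp
  have ae: "AE x in lborel. (\<integral>p. interaction r x p \<partial>(N \<Otimes>\<^sub>M N)) = local_potential r x * cnj (cauchy x)"
    using AE_abs_potential_finite by eventually_elim (rule integral_interaction)
  show "integrable lborel (\<lambda>x. local_potential r x * cnj (cauchy x))"
    by (rule integrable_cong_AE_imp[OF P.integrable_fst[OF int] _ ae]) measurable
  have "(\<integral>x. local_potential r x * cnj (cauchy x) \<partial>lborel) = (\<integral>x. (\<integral>p. interaction r x p \<partial>(N \<Otimes>\<^sub>M N)) \<partial>lborel)"
    using ae by (intro integral_cong_AE) auto
  also have "\<dots> = (\<integral>p. (\<integral>x. interaction r x p \<partial>lborel) \<partial>(N \<Otimes>\<^sub>M N))"
    by (rule P.Fubini_integral[OF int, symmetric])
  finally have eq: "Re (\<integral>x. local_potential r x * cnj (cauchy x) \<partial>lborel)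
      = (\<integral>p. Re (\<integral>x. interaction r x p \<partial>lborel) \<partial>(N \<Otimes>\<^sub>M N))"
    using integral_bounded_linear[OF bounded_linear_Re P.integrable_snd[OF int]] by simp
  have "ennreal (\<integral>p. Re (\<integral>x. interaction r x p \<partial>lborel) \<partial>(N \<Otimes>\<^sub>M N))
      \<le> (\<integral>\<^sup>+p. ennreal (Re (\<integral>x. interaction r x p \<partial>lborel)) \<partial>(N \<Otimes>\<^sub>M N))"
    by (rule ennreal_integral_le)
  also have "\<dots> \<le> (\<integral>\<^sup>+p. (\<integral>\<^sup>+v. ennreal (radial_weight r v) * indicator {v. norm (fst p - snd p) < norm v} v \<partial>lborel) \<partial>(N \<Otimes>\<^sub>M N))"
  proof (intro nn_integral_mono)
    fix p :: "complex \<times> complex"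
    have "(\<integral>x. interaction r x p \<partial>lborel) = (\<integral>v. interaction r (fst p + v) p \<partial>lborel)"
      by (rule integral_lborel_translate[symmetric]) measurable
    also have "\<dots> = (\<integral>v. local_kernel r v * cnj (inverse (v + (fst p - snd p))) \<partial>lborel)"
    proof -
      have "fst p + v - fst p = v" "fst p + v - snd p = v + (fst p - snd p)" for v
        by simp_all
      then show ?thesis by (simp only: interaction_def)
    qed
    finally have eq: "(\<integral>x. interaction r x p \<partial>lborel)
        = (\<integral>v. local_kernel r v * cnj (inverse (v + (fst p - snd p))) \<partial>lborel)" .
    show "ennreal (Re (\<integral>x. interaction r x p \<partial>lborel))
        \<le> (\<integral>\<^sup>+v. ennreal (radial_weight r v) * indicator {v. norm (fst p - snd p) < norm v} v \<partial>lborel)"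
      unfolding eq by (rule kernel_interaction_le[OF r])
  qed
  also have "\<dots> \<le> ennreal (mass * (2 * pi * C * r powr \<beta> / \<beta>))"
    by (rule interaction_energy_le[OF r])
  finally show "Re (\<integral>x. local_potential r x * cnj (cauchy x) \<partial>lborel) \<le> mass * (2 * pi * C * r powr \<beta> / \<beta>)"
    unfolding eq using C_pos \<beta>_pos by (subst (asm) ennreal_le_iff) auto
qed

section \<open>Decay at infinity and exhaustion by large discs\<close>

lemma norm_cauchy_far:
  assumes supp: "AE y in N. norm y < R0" and x: "R0 < norm x"
  shows "norm (cauchy x) \<le> mass / (norm x - R0)"
proof -
  have "abs_potential x \<le> (\<integral>\<^sup>+y. ennreal (1 / (norm x - R0)) \<partial>N)"
    unfolding abs_potential_def using supp
  proof (intro nn_integral_mono_AE, eventually_elim)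
    case (elim y)
    have "norm x - R0 \<le> norm (x - y)" using elim norm_triangle_ineq2[of x y] by linarith
    then have "norm (inverse (x - y)) \<le> 1 / (norm x - R0)"
      using x by (simp add: norm_divide inverse_eq_divide frac_le)
    then show ?case by (rule ennreal_leI)
  qed
  also have "\<dots> = ennreal (mass / (norm x - R0))"
    using x by (simp add: emeasure_UNIV flip: ennreal_mult)
  finally have "ennreal (norm (cauchy x)) \<le> ennreal (mass / (norm x - R0))"
    using norm_cauchy_le[of x] by (rule order_trans[rotated])
  then show ?thesis using x by (simp add: ennreal_le_iff)
qed

text \<open>The boundary term of the exhaustion. The integrand lives on
  \<open>R \<le> norm x < R + r\<close>, where the decay of \<open>cauchy\<close> bounds it. The
  area of this annulus grows only linearly in \<open>R\<close>, whereas the squared bound decays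
  quadratically.\<close>

lemma annulus_integral_le:
  assumes supp: "AE y in N. norm y < R0" and R: "R0 < R" "0 < R" and r: "0 < r"
  shows "(\<integral>x. indicator (ball 0 (R + r)) x * (norm (cauchy x))\<^sup>2 \<partial>lborel)
      - (\<integral>x. indicator (ball 0 R) x * (norm (cauchy x))\<^sup>2 \<partial>lborel)
    \<le> (mass / (R - R0))\<^sup>2 * (pi * (R + r)\<^sup>2 - pi * R\<^sup>2)"
proof -
  let ?P = "\<lambda>x. (norm (cauchy x))\<^sup>2"
  let ?i = "\<lambda>R. indicator (ball (0::complex) R) :: complex \<Rightarrow> real"
  have int: "integrable lborel (\<lambda>x. ?i R x * ?P x)" for R
    using cauchy_sq_integrable[of R 0] by simp
  have inti: "integrable lborel (?i R)" if "0 < R" for R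
    using that by (intro integrable_real_indicator) (simp_all add: emeasure_lborel_ball_complex)
  have "(\<integral>x. ?i (R + r) x * ?P x \<partial>lborel) - (\<integral>x. ?i R x * ?P x \<partial>lborel)
      = (\<integral>x. ?i (R + r) x * ?P x - ?i R x * ?P x \<partial>lborel)"
    by (intro Bochner_Integration.integral_diff[symmetric] int)
  also have "\<dots> \<le> (\<integral>x. (mass / (R - R0))\<^sup>2 * (?i (R + r) x - ?i R x) \<partial>lborel)"
  proof (intro integral_mono Bochner_Integration.integrable_diff integrable_mult_right int inti)
    fix x
    show "?i (R + r) x * ?P x - ?i R x * ?P x \<le> (mass / (R - R0))\<^sup>2 * (?i (R + r) x - ?i R x)"
    proof (cases "R \<le> norm x")
      case True
      have "norm (cauchy x) \<le> mass / (norm x - R0)"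
        using True R by (intro norm_cauchy_far[OF supp]) auto
      also have "\<dots> \<le> mass / (R - R0)"
        using True R by (intro divide_left_mono mult_pos_pos) auto
      finally have "?P x \<le> (mass / (R - R0))\<^sup>2" by (intro power_mono) auto
      then show ?thesis using True by (auto split: split_indicator)
    next
      case False
      then show ?thesis using r by (auto split: split_indicator)
    qed
  qed (use R r in auto)
  also have "\<dots> = (mass / (R - R0))\<^sup>2 * (pi * (R + r)\<^sup>2 - pi * R\<^sup>2)"
    using R r inti[of R] inti[of "R + r"] by (simp add: measure_lborel_ball_complex)
  finally show ?thesis .
qed

text \<open>\<open>sq_oscillation_eq\<close> is integrated over \<open>ball 0 R\<close>. By
  \<open>sq_average_ball\<close> the first two terms together are at most an annulus integral, which
  vanishes as \<open>R\<close> grows; the third term is the interaction integral.\<close>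

lemma sq_oscillation_integral_compact:
  assumes r: "0 < r" and supp: "AE y in N. norm y < R0"
  shows "(\<integral>\<^sup>+x. sq_oscillation r x \<partial>lborel)
    \<le> ennreal (2 * (pi * r\<^sup>2) * (mass * (2 * pi * C * r powr \<beta> / \<beta>)))"
proof -
  let ?M = "mass * (2 * pi * C * r powr \<beta> / \<beta>)"
  let ?c = "pi * r\<^sup>2"
  let ?P = "\<lambda>x. (norm (cauchy x))\<^sup>2"
  let ?i = "\<lambda>R. indicator (ball (0::complex) R) :: complex \<Rightarrow> real"
  define g where "g x = Re (local_potential r x * cnj (cauchy x))" for x
  have g: "integrable lborel g" "integral\<^sup>L lborel g \<le> ?M"
    unfolding g_def using local_potential_cauchy_integral[OF r supp]
    by (auto simp: integral_bounded_linear[OF bounded_linear_Re] intro!: integrable_Re simp del: times_complex.simps)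
  have g0: "g x = 0" if "R0 + r \<le> norm x" for x
  proof -
    have "local_potential r x = (\<integral>y. 0 \<partial>N)"
      unfolding local_potential_def
    proof (rule integral_cong_AE)
      show "AE y in N. local_kernel r (x - y) = 0"
        using supp
      proof eventually_elim
        case (elim y)
        have "\<not> norm (x - y) < r" using that elim norm_triangle_ineq2[of x y] by linarith
        then show ?case by (simp add: local_kernel_def)
      qed
    qed simp_all
    then show ?thesis by (simp add: g_def)
  qed
  \<comment> \<open>The boundary term followed by the bound for the interaction.\<close>
  define b where "b R = ?c * ((mass / (R - R0))\<^sup>2 * (pi * (R + r)\<^sup>2 - pi * R\<^sup>2)) + 2 * ?c * ?M" for R
  have ball: "(\<integral>\<^sup>+x. sq_oscillation r x * indicator (ball 0 R) x \<partial>lborel) \<le> ennreal (b R)"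
    if R: "R0 + r \<le> R" "0 < R" for R
  proof -
    \<comment> \<open>\<open>g\<close> carries no indicator: for \<open>R0 + r \<le> R\<close> it
      vanishes outside \<open>ball 0 R\<close>, so its integral over the disc is already the whole
      integral.\<close>
    let ?e = "\<lambda>x. ?i R x * sq_average r x - ?c * (?i R x * ?P x) + 2 * ?c * g x"
    have P: "integrable lborel (\<lambda>x. ?i R x * ?P x)"
      using cauchy_sq_integrable[of R 0] by simp
    note A = sq_average_ball[OF r, of R]
    have int: "integrable lborel ?e"
      by (intro Bochner_Integration.integrable_add Bochner_Integration.integrable_diff integrable_mult_right P A g)
    have ae: "AE x in lborel. sq_oscillation r x * indicator (ball 0 R) x = ennreal (?e x) \<and> 0 \<le> ?e x"
      using AE_abs_potential_finite
    proof eventually_elim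
      case (elim x)
      show ?case
        using sq_oscillation_eq[OF r elim] g0[of x] R
        by (cases "x \<in> ball 0 R") (simp_all add: g_def del: times_complex.simps)
    qed
    have "(\<integral>\<^sup>+x. sq_oscillation r x * indicator (ball 0 R) x \<partial>lborel) = (\<integral>\<^sup>+x. ennreal (?e x) \<partial>lborel)"
      using ae by (intro nn_integral_cong_AE) auto
    also have "\<dots> = ennreal (\<integral>x. ?e x \<partial>lborel)"
      using ae by (intro nn_integral_eq_integral int) auto
    also have "(\<integral>x. ?e x \<partial>lborel) = (\<integral>x. ?i R x * sq_average r x \<partial>lborel)
        - ?c * (\<integral>x. ?i R x * ?P x \<partial>lborel) + 2 * ?c * integral\<^sup>L lborel g"
      using P A(1) g(1) by simp
    also have "ennreal \<dots> \<le> ennreal (b R)"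
    proof (rule ennreal_leI)
      let ?I1 = "\<integral>x. ?i (R + r) x * ?P x \<partial>lborel" and ?I0 = "\<integral>x. ?i R x * ?P x \<partial>lborel"
      have "?c * (?I1 - ?I0) \<le> ?c * ((mass / (R - R0))\<^sup>2 * (pi * (R + r)\<^sup>2 - pi * R\<^sup>2))"
        using R r by (intro mult_left_mono annulus_integral_le[OF supp]) auto
      moreover have "2 * ?c * integral\<^sup>L lborel g \<le> 2 * ?c * ?M"
        using g(2) by (intro mult_left_mono) auto
      ultimately show "(\<integral>x. ?i R x * sq_average r x \<partial>lborel)
        - ?c * ?I0 + 2 * ?c * integral\<^sup>L lborel g \<le> b R"
        using A(2) unfolding b_def by (simp add: right_diff_distrib)
    qed
    finally show ?thesis .
  qed
  show ?thesis
  proof (rule nn_integral_le_of_tendsto)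
    show "AE x in lborel. (\<lambda>n. sq_oscillation r x * indicator (ball 0 (real n)) x) \<longlonglongrightarrow> sq_oscillation r x"
    proof (intro AE_I2 tendsto_eventually)
      fix x :: complex
      obtain n0 :: nat where n0: "norm x < real n0" using reals_Archimedean2 by blast
      show "\<forall>\<^sub>F n in sequentially. sq_oscillation r x * indicator (ball 0 (real n)) x = sq_oscillation r x"
        using eventually_ge_at_top[of n0]
        by eventually_elim (use n0 in auto)
    qed
    obtain n1 :: nat where n1: "max (R0 + r) 0 < real n1" using reals_Archimedean2 by blast
    show "\<forall>\<^sub>F n in sequentially. (\<integral>\<^sup>+x. sq_oscillation r x * indicator (ball 0 (real n)) x \<partial>lborel) \<le> ennreal (b (real n))"
      using eventually_ge_at_top[of n1]
      by eventually_elim (use n1 in \<open>auto intro!: ball\<close>)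
    have "(\<lambda>n. b (real n)) \<longlonglongrightarrow> 0 + 2 * ?c * ?M"
      unfolding b_def
    proof (intro tendsto_add tendsto_const)
      show "(\<lambda>n. ?c * ((mass / (real n - R0))\<^sup>2 * (pi * (real n + r)\<^sup>2 - pi * (real n)\<^sup>2))) \<longlonglongrightarrow> 0"
      proof -
        \<comment> \<open>The annulus has area \<open>pi * r * (2 * n + r)\<close>.\<close>
        have "(\<lambda>n. (2 * real n + r) / (real n - R0)\<^sup>2) \<longlonglongrightarrow> 0"
          by real_asymp
        from tendsto_mult_right_zero[OF this, of "?c * mass\<^sup>2 * pi * r"]
        show ?thesis
          by (rule Lim_transform_eventually) (simp add: power2_eq_square field_simps)
      qed
    qed
    then show "(\<lambda>n. b (real n)) \<longlonglongrightarrow> 2 * ?c * ?M" by simp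
  qed measurable
qed

end

section \<open>Measures without compact support\<close>

lemma growth_measure_restrict:
  assumes "growth_measure N C \<beta>"
  shows "growth_measure (density N (indicator (ball 0 R))) C \<beta>"
proof -
  interpret growth_measure N C \<beta> by fact
  have le: "emeasure (density N (indicator (ball 0 R))) A \<le> emeasure N A" if "A \<in> sets borel" for A
  proof -
    have "emeasure (density N (indicator (ball 0 R))) A = (\<integral>\<^sup>+x. indicator (ball 0 R) x * indicator A x \<partial>N)"
      using that by (intro emeasure_density) auto
    also have "\<dots> \<le> (\<integral>\<^sup>+x. indicator A x \<partial>N)"
      by (intro nn_integral_mono) (auto split: split_indicator)
    also have "\<dots> = emeasure N A" using that by simp
    finally show ?thesis .
  qed
  show ?thesis
  proof (intro growth_measure.intro growth_measure_axioms.intro finite_measureI)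
    show "emeasure (density N (indicator (ball 0 R))) (space (density N (indicator (ball 0 R)))) \<noteq> \<infinity>"
      using le[of UNIV] emeasure_UNIV by (auto simp: top_unique)
    show "emeasure (density N (indicator (ball 0 R))) (cball x t) \<le> ennreal (C * t powr \<beta>)" if "0 < t" for x t
      using le[of "cball x t"] growth[OF that, of x] by simp
  qed (simp_all add: C_pos \<beta>_pos)
qed

context growth_measure
begin

text \<open>Dominated convergence; the majorant \<open>norm (inverse (x - y))\<close> is integrable
  because \<open>abs_potential x\<close> is finite.\<close>

lemma cauchy_restrict_tendsto:
  assumes "abs_potential x < \<infinity>"
  shows "(\<lambda>n. growth_measure.cauchy (density N (indicator (ball 0 (real n)))) x) \<longlonglongrightarrow> cauchy x"
proof -
  have eq: "growth_measure.cauchy (density N (indicator (ball 0 (real n)))) x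
      = (\<integral>y. indicator (ball 0 (real n)) y *\<^sub>R inverse (x - y) \<partial>N)" for n
  proof -
    interpret R: growth_measure "density N (indicator (ball 0 (real n)))" C \<beta>
      by (intro growth_measure_restrict growth_measure_axioms)
    have ind: "(indicator A :: complex \<Rightarrow> ennreal) = (\<lambda>y. ennreal (indicator A y))" for A
      by (auto split: split_indicator)
    show ?thesis
      unfolding R.cauchy_def unfolding ind by (rule integral_density) auto
  qed
  show ?thesis
    unfolding eq unfolding cauchy_def
  proof (rule integral_dominated_convergence)
    show "integrable N (\<lambda>y. norm (inverse (x - y)))"
      using integrable_kernel[OF assms] by (rule integrable_norm)
    show "AE y in N. (\<lambda>n. indicator (ball 0 (real n)) y *\<^sub>R inverse (x - y)) \<longlonglongrightarrow> inverse (x - y)"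
    proof (intro AE_I2 tendsto_eventually)
      fix y :: complex
      obtain n0 :: nat where n0: "norm y < real n0" using reals_Archimedean2 by blast
      show "\<forall>\<^sub>F n in sequentially. indicator (ball 0 (real n)) y *\<^sub>R inverse (x - y) = inverse (x - y)"
        using eventually_ge_at_top[of n0]
        by eventually_elim (use n0 in auto)
    qed
    show "AE y in N. norm (indicator (ball 0 (real n)) y *\<^sub>R inverse (x - y)) \<le> norm (inverse (x - y))" for n
      by (auto split: split_indicator)
  qed simp_all
qed

lemma AE_abs_potential_translate_finite: "AE h in lborel. abs_potential (x + h) < \<infinity>"
proof -
  have "AE h in distr lborel borel ((+) x). abs_potential h < \<infinity>"
    unfolding lborel_distr_plus by (rule AE_abs_potential_finite)
  then show ?thesis by (subst (asm) AE_distr_iff) auto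
qed

text \<open>Fatou's lemma is used twice, first in \<open>h\<close> for fixed \<open>x\<close> and
  then in \<open>x\<close>. The restrictions to discs have bounded support, the same
  \<open>C\<close> and \<open>\<beta>\<close>, and mass at most \<open>mass\<close>, so their bounds
  are uniform.\<close>

lemma sq_oscillation_integral:
  assumes r: "0 < r"
  shows "(\<integral>\<^sup>+x. sq_oscillation r x \<partial>lborel)
    \<le> ennreal (2 * (pi * r\<^sup>2) * (mass * (2 * pi * C * r powr \<beta> / \<beta>)))"
proof -
  let ?N = "\<lambda>n. density N (indicator (ball 0 (real n)))"
  let ?B = "2 * (pi * r\<^sup>2) * (mass * (2 * pi * C * r powr \<beta> / \<beta>))"
  interpret R: growth_measure "?N n" C \<beta> for n
    by (intro growth_measure_restrict growth_measure_axioms)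
  have pw: "AE x in lborel. sq_oscillation r x \<le> liminf (\<lambda>n. R.sq_oscillation n r x)"
    using AE_abs_potential_finite
  proof eventually_elim
    case (elim x)
    let ?u = "\<lambda>n h. ennreal ((norm (R.cauchy n (x + h) - R.cauchy n x))\<^sup>2) * indicator (ball 0 r) h"
    have "AE h in lborel. (\<lambda>n. ?u n h) \<longlonglongrightarrow>
        ennreal ((norm (cauchy (x + h) - cauchy x))\<^sup>2) * indicator (ball 0 r) h"
      using AE_abs_potential_translate_finite[of x]
    proof eventually_elim
      case (elim h)
      then show ?case
        using cauchy_restrict_tendsto[OF elim] cauchy_restrict_tendsto[OF \<open>abs_potential x < \<infinity>\<close>]
        by (cases "h \<in> ball 0 r") (auto intro!: tendsto_intros)
    qed
    then have "sq_oscillation r x = (\<integral>\<^sup>+h. liminf (\<lambda>n. ?u n h) \<partial>lborel)"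
      unfolding sq_oscillation_def
      by (intro nn_integral_cong_AE) (auto elim!: eventually_mono simp: lim_imp_Liminf)
    also have "\<dots> \<le> liminf (\<lambda>n. \<integral>\<^sup>+h. ?u n h \<partial>lborel)"
      by (rule nn_integral_liminf) measurable
    finally show ?case by (simp only: R.sq_oscillation_def)
  qed
  have bound: "(\<integral>\<^sup>+x. R.sq_oscillation n r x \<partial>lborel) \<le> ennreal ?B" for n
  proof -
    have supp: "AE y in ?N n. norm y < real n"
      by (subst AE_density) (auto split: split_indicator)
    have "emeasure (?N n) UNIV = emeasure N (ball 0 (real n))"
      by (subst emeasure_density) auto
    also have "\<dots> \<le> emeasure N UNIV" by (intro emeasure_mono) auto
    finally have "R.mass n \<le> mass"
      unfolding R.emeasure_UNIV emeasure_UNIV by (simp add: ennreal_le_iff)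
    then have "2 * (pi * r\<^sup>2) * (R.mass n * (2 * pi * C * r powr \<beta> / \<beta>)) \<le> ?B"
      using C_pos \<beta>_pos by (intro mult_left_mono mult_right_mono) auto
    with R.sq_oscillation_integral_compact[OF r supp] show ?thesis
      by (meson ennreal_leI order_trans)
  qed
  have "(\<integral>\<^sup>+x. sq_oscillation r x \<partial>lborel) \<le> (\<integral>\<^sup>+x. liminf (\<lambda>n. R.sq_oscillation n r x) \<partial>lborel)"
    using pw by (rule nn_integral_mono_AE)
  also have "\<dots> \<le> liminf (\<lambda>n. \<integral>\<^sup>+x. R.sq_oscillation n r x \<partial>lborel)"
    by (rule nn_integral_liminf) measurable
  also have "\<dots> \<le> liminf (\<lambda>n. ennreal ?B)"
    using bound by (intro Liminf_mono always_eventually) auto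
  also have "\<dots> = ennreal ?B" by (simp add: Liminf_const)
  finally show ?thesis .
qed

end

section \<open>From the Cauchy kernel to the Biot-Savart kernel\<close>

definition kernel_rotation :: "complex \<Rightarrow> real^2" where
  "kernel_rotation z = (1 / (2 * pi)) *\<^sub>R vector [Im z, Re z]"

text \<open>In complex notation the map is \<open>\<i> * cnj z / (2 * pi)\<close>: a conjugation, a
  quarter turn and a scaling.\<close>

lemma bounded_linear_kernel_rotation: "bounded_linear kernel_rotation"
  and norm_kernel_rotation: "norm (kernel_rotation z) = norm z / (2 * pi)"
proof -
  have eq: "kernel_rotation z = vec_of_complex (complex_of_real (1 / (2 * pi)) * (\<i> * cnj z))" for z
    by (simp add: kernel_rotation_def vec_of_complex_def vec_eq_iff forall_2)
  show "norm (kernel_rotation z) = norm z / (2 * pi)"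
    unfolding eq by (simp add: norm_mult norm_divide)
  show "bounded_linear kernel_rotation"
    unfolding eq[abs_def]
    by (intro bounded_linear_compose[OF bounded_linear_vec_of_complex]
        bounded_linear_compose[OF bounded_linear_mult_right] bounded_linear_cnj)
qed

lemma biot_savart_kernel_eq: "biot_savart_kernel v = kernel_rotation (inverse (complex_of_vec v))"
proof -
  have "(norm v)\<^sup>2 = (v $ 1)\<^sup>2 + (v $ 2)\<^sup>2"
    by (simp add: norm_vec_def L2_set_def sum_2)
  then have inv: "inverse (complex_of_vec v) = Complex (v $ 1 / (norm v)\<^sup>2) (- (v $ 2) / (norm v)\<^sup>2)"
    by (simp add: complex_eq_iff complex_of_vec_def)
  show ?thesis
    unfolding biot_savart_kernel_def perp_def kernel_rotation_def inv complex.sel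
    by (simp add: vec_eq_iff forall_2 inverse_eq_divide)
qed

text \<open>\<open>kernel_rotation\<close> has a bounded linear left inverse, so it commutes with
  the Bochner integral even where the integrand is not integrable and both integrals take the
  default value 0. Hence the identity holds at every \<open>x\<close>.\<close>

lemma integral_biot_savart_kernel:
  assumes M: "sets M = sets borel"
  shows "(\<integral>y. biot_savart_kernel (x - y) \<partial>M)
    = kernel_rotation (\<integral>y. inverse (complex_of_vec x - y) \<partial>(distr M borel complex_of_vec))"
proof -
  have [measurable]: "complex_of_vec \<in> measurable M borel"
    using measurable_complex_of_vec M measurable_cong_sets[OF M refl] by blast
  let ?T' = "\<lambda>x :: real^2. (2 * pi) *\<^sub>R Complex (x $ 2) (x $ 1)"
  have T': "?T' = (\<lambda>x. complex_of_real (2 * pi) * (\<i> * cnj (complex_of_vec x)))"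
    by (auto simp: complex_of_vec_def complex_eq_iff)
  have "bounded_linear ?T'"
    unfolding T' by (intro bounded_linear_compose[OF bounded_linear_mult_right]
        bounded_linear_compose[OF bounded_linear_cnj] bounded_linear_complex_of_vec)
  moreover have "?T' (kernel_rotation z) = z" for z
    by (simp add: kernel_rotation_def complex_eq_iff)
  ultimately have "(\<integral>y. kernel_rotation (inverse (complex_of_vec x - complex_of_vec y)) \<partial>M)
      = kernel_rotation (\<integral>y. inverse (complex_of_vec x - complex_of_vec y) \<partial>M)"
    by (intro integral_bounded_linear'[OF bounded_linear_kernel_rotation]) auto
  then show ?thesis
    by (simp add: biot_savart_kernel_eq complex_of_vec_diff integral_distr)
qed

lemma nn_integral_complex_of_vec:
  fixes f :: "complex \<Rightarrow> ennreal"
  assumes [measurable]: "f \<in> borel_measurable borel"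
  shows "(\<integral>\<^sup>+x. f (complex_of_vec x) \<partial>lborel) = (\<integral>\<^sup>+x. f x \<partial>lborel)"
  by (subst lborel_distr_complex_of_vec[symmetric]) (simp add: nn_integral_distr)

text \<open>The identification is an isometry, so discs pull back to discs of the same radius and
  the constants survive.\<close>

lemma growth_measure_distr:
  assumes M: "sets M = sets borel" "emeasure M UNIV < \<infinity>" and "0 < C" "0 < \<beta>"
    and growth: "\<And>x t. 0 < t \<Longrightarrow> emeasure M (cball x t) \<le> ennreal (C * t powr \<beta>)"
  shows "growth_measure (distr M borel complex_of_vec) C \<beta>"
proof (intro growth_measure.intro growth_measure_axioms.intro finite_measureI)
  have [measurable]: "complex_of_vec \<in> measurable M borel"
    using measurable_complex_of_vec measurable_cong_sets[OF M(1) refl] by blast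
  have sp: "space M = UNIV" using sets_eq_imp_space_eq[OF M(1)] by simp
  show "emeasure (distr M borel complex_of_vec) (space (distr M borel complex_of_vec)) \<noteq> \<infinity>"
    using M(2) by (simp add: emeasure_distr sp)
  show "emeasure (distr M borel complex_of_vec) (cball x t) \<le> ennreal (C * t powr \<beta>)" if "0 < t" for x t
  proof -
    have "dist x (complex_of_vec y) = dist (vec_of_complex x) y" for y
      using norm_complex_of_vec[of "vec_of_complex x - y"] by (simp add: complex_of_vec_diff dist_norm)
    then have "complex_of_vec -` cball x t = cball (vec_of_complex x) t"
      by auto
    then show ?thesis using growth[OF that, of "vec_of_complex x"] by (simp add: emeasure_distr sp)
  qed
qed (use assms in simp_all)

lemma norm_diff_sq_le:
  fixes a b :: "'a::real_inner"
  shows "(norm (a - b))\<^sup>2 \<le> 2 * (norm a)\<^sup>2 + 2 * (norm b)\<^sup>2"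
proof -
  have "0 \<le> (norm (a + b))\<^sup>2" by simp
  then show ?thesis
    by (simp add: power2_norm_eq_inner inner_simps inner_commute)
qed

section \<open>The estimate for signed vorticity\<close>

theorem corollary2p15:
  fixes \<omega> :: "(real^2) set \<Rightarrow> real" and u :: "real^2 \<Rightarrow> real^2" and C \<beta> :: real
  assumes "\<omega> \<in> finite_signed_measures"
    and "distribution_of \<omega> \<in> H_minus1_loc"
    and "u = velocity \<omega>"
    and "C > 0" and "\<beta> > 0"
    and "\<forall>r>0. vort_maximal r \<omega> \<le> ennreal (C * r powr \<beta>)"
  shows "\<forall>r>0.
     (\<integral>\<^sup>+h\<in>ball 0 r. (\<integral>\<^sup>+x. ennreal ((norm (u (x + h) - u x))\<^sup>2) \<partial>lborel) \<partial>lborel)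
        / emeasure lborel (ball (0::real^2) r)
     \<le> ennreal (C / \<beta> * tv_norm \<omega> * r powr \<beta>)"
proof (intro allI impI)
  fix r :: real assume r: "0 < r"
  obtain P where P: "P \<in> sets borel"
    "\<And>A. A \<in> sets borel \<Longrightarrow> 0 \<le> \<omega> (A \<inter> P)" "\<And>A. A \<in> sets borel \<Longrightarrow> \<omega> (A - P) \<le> 0"
    "\<And>A. A \<in> sets borel \<Longrightarrow> variation \<omega> A = ennreal (\<omega> (A \<inter> P) - \<omega> (A - P))"
    "\<And>A. A \<in> sets borel \<Longrightarrow> emeasure (pos_part_measure \<omega>) A = ennreal (\<omega> (A \<inter> P))"
    "\<And>A. A \<in> sets borel \<Longrightarrow> emeasure (neg_part_measure \<omega>) A = ennreal (- \<omega> (A - P))"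
    using Jordan_decomposition[OF assms(1)] by metis
  have sets: "sets (pos_part_measure \<omega>) = sets borel" "sets (neg_part_measure \<omega>) = sets borel"
    using sets.sigma_sets_eq[of "borel :: (real^2) measure"]
    by (simp_all add: pos_part_measure_def neg_part_measure_def)
  have var: "variation \<omega> (cball x t) \<le> ennreal (C * t powr \<beta>)" if "0 < t" for x t
  proof -
    have "variation \<omega> (cball x t) \<le> vort_maximal t \<omega>"
      unfolding vort_maximal_def by (rule SUP_upper) simp
    then show ?thesis using assms(6) that by (meson order_trans)
  qed
  \<comment> \<open>Both Jordan parts lie below the variation, so each inherits the growth bound
    with the same \<open>C\<close> and \<open>\<beta>\<close>.\<close>
  have le: "emeasure (pos_part_measure \<omega>) A \<le> variation \<omega> A"
    "emeasure (neg_part_measure \<omega>) A \<le> variation \<omega> A" if "A \<in> sets borel" for A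
    using P(2,3)[OF that] by (simp_all add: P(4-6)[OF that] ennreal_leI)
  have fin: "emeasure (pos_part_measure \<omega>) UNIV < \<infinity>" "emeasure (neg_part_measure \<omega>) UNIV < \<infinity>"
    by (simp_all add: P(5,6))
  interpret p: growth_measure "distr (pos_part_measure \<omega>) borel complex_of_vec" C \<beta>
    by (intro growth_measure_distr sets fin assms(4,5) order_trans[OF le(1) var]) simp
  interpret n: growth_measure "distr (neg_part_measure \<omega>) borel complex_of_vec" C \<beta>
    by (intro growth_measure_distr sets fin assms(4,5) order_trans[OF le(2) var]) simp
  have meas: "complex_of_vec \<in> measurable (pos_part_measure \<omega>) borel"
    "complex_of_vec \<in> measurable (neg_part_measure \<omega>) borel"
    using measurable_complex_of_vec measurable_cong_sets[OF sets(1) refl] measurable_cong_sets[OF sets(2) refl]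
    by blast+
  have sp: "space (pos_part_measure \<omega>) = UNIV" "space (neg_part_measure \<omega>) = UNIV"
    using sets_eq_imp_space_eq[OF sets(1)] sets_eq_imp_space_eq[OF sets(2)] by simp_all
  have mass: "p.mass = \<omega> (UNIV \<inter> P)" "n.mass = - \<omega> (UNIV - P)"
    using P(2,3)[of UNIV] P(5,6)[of UNIV]
    by (simp_all add: p.mass_def n.mass_def measure_distr meas sp measure_def emeasure_distr)
  \<comment> \<open>The masses add up exactly to the total variation, so bounds linear in the mass
    combine without loss.\<close>
  have tv: "tv_norm \<omega> = p.mass + n.mass"
    using P(2-4)[of UNIV] by (simp add: tv_norm_def mass)
  let ?p = "\<lambda>x h. ennreal ((norm (p.cauchy (x + h) - p.cauchy x))\<^sup>2)"
  let ?n = "\<lambda>x h. ennreal ((norm (n.cauchy (x + h) - n.cauchy x))\<^sup>2)"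
  \<comment> \<open>The factor 2 of \<open>norm_diff_sq_le\<close> over \<open>(2 * pi)^2\<close>,
    from the kernel. \<open>?K\<close> is the bound of \<open>sq_oscillation_integral\<close> per
    unit of mass.\<close>
  let ?c = "1 / (2 * pi\<^sup>2)"
  let ?K = "2 * (pi * r\<^sup>2) * (2 * pi * C * r powr \<beta> / \<beta>)"
  have u: "u x = kernel_rotation (p.cauchy (complex_of_vec x) - n.cauchy (complex_of_vec x))" for x
    unfolding assms(3) velocity_def signed_integral_def p.cauchy_def n.cauchy_def
      integral_biot_savart_kernel[OF sets(1)] integral_biot_savart_kernel[OF sets(2)]
    by (simp add: bounded_linear.linear[OF bounded_linear_kernel_rotation] linear_diff)
  have pw: "ennreal ((norm (u (x + h) - u x))\<^sup>2)
      \<le> ennreal ?c * (?p (complex_of_vec x) (complex_of_vec h) + ?n (complex_of_vec x) (complex_of_vec h))" for x h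
  proof -
    let ?X = "complex_of_vec x" and ?H = "complex_of_vec h"
    have "norm (u (x + h) - u x)
        = norm ((p.cauchy (?X + ?H) - p.cauchy ?X) - (n.cauchy (?X + ?H) - n.cauchy ?X)) / (2 * pi)"
      unfolding u linear_diff[OF bounded_linear.linear[OF bounded_linear_kernel_rotation], symmetric]
        norm_kernel_rotation complex_of_vec_add by (simp add: algebra_simps)
    then have "(norm (u (x + h) - u x))\<^sup>2
        = (norm ((p.cauchy (?X + ?H) - p.cauchy ?X) - (n.cauchy (?X + ?H) - n.cauchy ?X)))\<^sup>2 / (4 * pi\<^sup>2)"
      by (simp add: power_divide power_mult_distrib)
    also have "\<dots> \<le> (2 * (norm (p.cauchy (?X + ?H) - p.cauchy ?X))\<^sup>2
        + 2 * (norm (n.cauchy (?X + ?H) - n.cauchy ?X))\<^sup>2) / (4 * pi\<^sup>2)"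
      by (intro divide_right_mono norm_diff_sq_le) simp
    also have "\<dots> = ?c * ((norm (p.cauchy (?X + ?H) - p.cauchy ?X))\<^sup>2
        + (norm (n.cauchy (?X + ?H) - n.cauchy ?X))\<^sup>2)"
      by (simp add: field_simps)
    finally show ?thesis
      by (simp add: ennreal_leI flip: ennreal_mult ennreal_plus)
  qed
  have swap: "(\<integral>\<^sup>+h. (\<integral>\<^sup>+x. ?p x h * indicator (ball 0 r) h \<partial>lborel) \<partial>lborel) \<le> ennreal (p.mass * ?K)"
    "(\<integral>\<^sup>+h. (\<integral>\<^sup>+x. ?n x h * indicator (ball 0 r) h \<partial>lborel) \<partial>lborel) \<le> ennreal (n.mass * ?K)"
  proof -
    have "(\<integral>\<^sup>+h. (\<integral>\<^sup>+x. ?p x h * indicator (ball 0 r) h \<partial>lborel) \<partial>lborel) = (\<integral>\<^sup>+x. p.sq_oscillation r x \<partial>lborel)"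
      unfolding p.sq_oscillation_def by (rule lborel_pair.Fubini') measurable
    then show "(\<integral>\<^sup>+h. (\<integral>\<^sup>+x. ?p x h * indicator (ball 0 r) h \<partial>lborel) \<partial>lborel) \<le> ennreal (p.mass * ?K)"
      using p.sq_oscillation_integral[OF r] by (simp add: mult_ac)
    have "(\<integral>\<^sup>+h. (\<integral>\<^sup>+x. ?n x h * indicator (ball 0 r) h \<partial>lborel) \<partial>lborel) = (\<integral>\<^sup>+x. n.sq_oscillation r x \<partial>lborel)"
      unfolding n.sq_oscillation_def by (rule lborel_pair.Fubini') measurable
    then show "(\<integral>\<^sup>+h. (\<integral>\<^sup>+x. ?n x h * indicator (ball 0 r) h \<partial>lborel) \<partial>lborel) \<le> ennreal (n.mass * ?K)"
      using n.sq_oscillation_integral[OF r] by (simp add: mult_ac)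
  qed
  let ?G = "\<lambda>x h. ennreal ?c * (?p x h + ?n x h)"
  have "(\<integral>\<^sup>+h\<in>ball 0 r. (\<integral>\<^sup>+x. ennreal ((norm (u (x + h) - u x))\<^sup>2) \<partial>lborel) \<partial>lborel)
      \<le> (\<integral>\<^sup>+h. (\<integral>\<^sup>+x. ?G (complex_of_vec x) (complex_of_vec h) \<partial>lborel) * indicator (ball 0 r) (complex_of_vec h) \<partial>lborel)"
    by (intro nn_integral_mono mult_mono pw) (auto split: split_indicator)
  \<comment> \<open>The identification preserves Lebesgue measure; the inner variable is moved to
    the complex plane first, then the outer one.\<close>
  also have "\<dots> = (\<integral>\<^sup>+h. (\<integral>\<^sup>+x. ?G x (complex_of_vec h) \<partial>lborel) * indicator (ball 0 r) (complex_of_vec h) \<partial>lborel)"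
    by (subst nn_integral_complex_of_vec) simp_all
  also have "\<dots> = (\<integral>\<^sup>+h. (\<integral>\<^sup>+x. ?G x h \<partial>lborel) * indicator (ball 0 r) h \<partial>lborel)"
    by (rule nn_integral_complex_of_vec[of "\<lambda>h. (\<integral>\<^sup>+x. ?G x h \<partial>lborel) * indicator (ball 0 r) h"]) measurable
  also have "\<dots> = (\<integral>\<^sup>+h. (\<integral>\<^sup>+x. ennreal ?c * (?p x h * indicator (ball 0 r) h + ?n x h * indicator (ball 0 r) h) \<partial>lborel) \<partial>lborel)"
    by (subst nn_integral_multc[symmetric]) (simp_all add: mult.assoc distrib_right)
  also have "\<dots> = ennreal ?c * ((\<integral>\<^sup>+h. (\<integral>\<^sup>+x. ?p x h * indicator (ball 0 r) h \<partial>lborel) \<partial>lborel)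
      + (\<integral>\<^sup>+h. (\<integral>\<^sup>+x. ?n x h * indicator (ball 0 r) h \<partial>lborel) \<partial>lborel))"
    by (subst nn_integral_cmult, measurable, subst nn_integral_cmult, measurable,
        subst nn_integral_add, measurable, subst nn_integral_add, measurable)
  also have "\<dots> \<le> ennreal ?c * (ennreal (p.mass * ?K) + ennreal (n.mass * ?K))"
    by (intro mult_left_mono add_mono swap) simp
  also have "\<dots> = ennreal (?c * (tv_norm \<omega> * ?K))"
  proof -
    have "ennreal c * (ennreal (a * k) + ennreal (b * k)) = ennreal (c * ((a + b) * k))"
      if "0 \<le> a" "0 \<le> b" "0 \<le> c" "0 \<le> k" for a b c k :: real
      using that by (simp add: distrib_right flip: ennreal_plus ennreal_mult)
    then show ?thesis unfolding tv by this (use assms(4,5) in simp_all)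
  qed
  finally have E: "(\<integral>\<^sup>+h\<in>ball 0 r. (\<integral>\<^sup>+x. ennreal ((norm (u (x + h) - u x))\<^sup>2) \<partial>lborel) \<partial>lborel)
      \<le> ennreal (?c * (tv_norm \<omega> * ?K))" .
  have "0 \<le> tv_norm \<omega>" by (simp add: tv)
  have ball: "emeasure lborel (ball (0::real^2) r) = ennreal (pi * r\<^sup>2)"
    using r by (simp add: emeasure_ball unit_ball_vol_2)
  have "(\<integral>\<^sup>+h\<in>ball 0 r. (\<integral>\<^sup>+x. ennreal ((norm (u (x + h) - u x))\<^sup>2) \<partial>lborel) \<partial>lborel)
        / emeasure lborel (ball (0::real^2) r)
      \<le> ennreal (?c * (tv_norm \<omega> * ?K)) / ennreal (pi * r\<^sup>2)"
    unfolding ball by (intro divide_right_mono_ennreal E)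
  also have "\<dots> = ennreal (?c * (tv_norm \<omega> * ?K) / (pi * r\<^sup>2))"
    using r \<open>0 \<le> tv_norm \<omega>\<close> assms(4,5) by (intro divide_ennreal) auto
  \<comment> \<open>All constants collapse to \<open>2 / pi\<close>, which is at most 1.\<close>
  also have "?c * (tv_norm \<omega> * ?K) / (pi * r\<^sup>2) = (2 / pi) * (C / \<beta> * tv_norm \<omega> * r powr \<beta>)"
    using r assms(5) by (simp add: field_simps power2_eq_square)
  also have "ennreal \<dots> \<le> ennreal (1 * (C / \<beta> * tv_norm \<omega> * r powr \<beta>))"
    using \<open>0 \<le> tv_norm \<omega>\<close> assms(4,5) pi_ge_two by (intro ennreal_leI mult_right_mono) auto
  finally show "(\<integral>\<^sup>+h\<in>ball 0 r. (\<integral>\<^sup>+x. ennreal ((norm (u (x + h) - u x))\<^sup>2) \<partial>lborel) \<partial>lborel)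
        / emeasure lborel (ball (0::real^2) r)
     \<le> ennreal (C / \<beta> * tv_norm \<omega> * r powr \<beta>)" by simp
qed

end
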